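(* Let $X$ be a compact metric space with its Borel $\sigma$-algebra, $r:X\to X$ a measurable onto map with $\#r^{-1}(x)<\infty$ for all $x$, $\mu$ a strongly $r$-invariant probability measure on $X$, $m_0\in L^\infty(X)$, and $h\in L^1(X)$ with $h\ge 0$ and $Rh=h$. Suppose $m_0$ is non-singular, i.e. it does not vanish on a set of positive measure. Define, on $L^2(X_\infty,\hat\mu)$, $$Uf=m_0\, f\circ\hat r,\qquad \pi(g)f=gf\quad(g\in L^\infty(X)),\qquad \varphi=1 .$$ Then $(L^2(X_\infty,\hat\mu),U,\pi,\varphi)$ is the covariant system associated to $m_0$ and $h$, that is: $U$ is unitary, $\pi$ is a representation of $L^\infty(X)$, and $$U\pi(f)U^{-1}=\pi(f\circ r)\quad(f\in L^\infty(X)),\qquad \langle\varphi\mid\pi(f)\varphi\rangle=\int_X fh\,\mathrm{d}\mu\quad(f\in L^\infty(X)),$$ $$U\varphi=\pi(m_0)\varphi,\qquad \overline{\mathrm{span}}\{U^{-n}\pi(f)\varphi : n\ge0,\ f\in L^\infty(X)\}=L^2(X_\infty,\hat\mu).$$ Moreover, if $M_gf=gf$ for $g\in L^\infty(X_\infty,\hat\mu)$ and $f\in L^2(X_\infty,\hat\mu)$, then $$UM_gU^{-1}=M_{g\circ\hat r}.$$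
   Context: Strong $r$-invariance of $\mu$: $\int_X f\,\mathrm{d}\mu=\int_X\frac{1}{\#r^{-1}(x)}\sum_{r(y)=x}f(y)\,\mathrm{d}\mu(x)$ for all $f\in L^\infty(X)$. Here $L^p(X)=L^p(X,\mu)$. The operator $R$ is $(R\xi)(x)=\frac{1}{\#r^{-1}(x)}\sum_{r(y)=x}|m_0(y)|^2\xi(y)$. $X_\infty=\{\hat x=(x_0,x_1,\dots) : x_n\in X,\ r(x_{n+1})=x_n \text{ for all } n\ge 0\}$, $\theta_n(\hat x)=x_n$, with the $\sigma$-algebra generated by the maps $\theta_n$. The map $\hat r:X_\infty\to X_\infty$, $\hat r(\hat x)=(r(x_0),x_0,x_1,\dots)$, is a bijection with inverse $\hat r^{-1}(\hat x)=(x_1,x_2,\dots)$. The measure $\hat\mu$ is the unique measure on $X_\infty$ with $\int_{X_\infty}f\circ\theta_n\,\mathrm{d}\hat\mu=\int_XR^n(fh)\,\mathrm{d}\mu$ for all $n\ge0$, $f\in L^\infty(X)$. Functions $g$ on $X$ are regarded as functions on $X_\infty$ via $g(\hat x)=g(x_0)$, i.e. $g\circ\theta_0$; so $(Uf)(\hat x)=m_0(x_0)f(\hat r(\hat x))$. Inner products are linear in the second variable. *)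

theory Defs
  imports "HOL-Probability.Probability"
begin

section \<open>Function spaces\<close>

text \<open>
  Elements of $L^2$ are genuine almost-everywhere classes.  Operations on classes are unions over
  all choices of representatives, so an operation which is not well defined on classes does not
  return a class; in particular, mapping \<open>L2 M\<close> into itself includes well-definedness.

  Elements of $L^\infty$ are given by representing functions; dependence on the class only is
  stated where it is not automatic (see \<open>Linf_representation\<close>).
\<close>

definition Linf :: "'b measure \<Rightarrow> ('b \<Rightarrow> complex) set" where
  "Linf M = {f \<in> borel_measurable M. \<exists>C. AE x in M. cmod (f x) \<le> C}"

definition ae_class :: "'b measure \<Rightarrow> ('b \<Rightarrow> complex) \<Rightarrow> ('b \<Rightarrow> complex) set" where
  "ae_class M f = {g \<in> borel_measurable M. AE x in M. g x = f x}"

definition L2 :: "'b measure \<Rightarrow> ('b \<Rightarrow> complex) set set" where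
  "L2 M = ae_class M ` {f \<in> borel_measurable M. integrable M (\<lambda>x. (cmod (f x))\<^sup>2)}"

definition ae_lift ::
  "'b measure \<Rightarrow> (('b \<Rightarrow> complex) \<Rightarrow> 'b \<Rightarrow> complex) \<Rightarrow> ('b \<Rightarrow> complex) set \<Rightarrow> ('b \<Rightarrow> complex) set" where
  "ae_lift M T F = (\<Union>f\<in>F. ae_class M (T f))"

definition L2_zero :: "'b measure \<Rightarrow> ('b \<Rightarrow> complex) set" where
  "L2_zero M = ae_class M (\<lambda>_. 0)"

definition L2_add ::
  "'b measure \<Rightarrow> ('b \<Rightarrow> complex) set \<Rightarrow> ('b \<Rightarrow> complex) set \<Rightarrow> ('b \<Rightarrow> complex) set" where
  "L2_add M F G = (\<Union>f\<in>F. \<Union>g\<in>G. ae_class M (\<lambda>x. f x + g x))"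

definition L2_scale ::
  "'b measure \<Rightarrow> complex \<Rightarrow> ('b \<Rightarrow> complex) set \<Rightarrow> ('b \<Rightarrow> complex) set" where
  "L2_scale M c = ae_lift M (\<lambda>f x. c * f x)"

definition L2_inner ::
  "'b measure \<Rightarrow> ('b \<Rightarrow> complex) set \<Rightarrow> ('b \<Rightarrow> complex) set \<Rightarrow> complex" where
  "L2_inner M F G = (THE c. \<forall>f\<in>F. \<forall>g\<in>G. c = (\<integral>x. cnj (f x) * g x \<partial>M))"

definition L2_norm :: "'b measure \<Rightarrow> ('b \<Rightarrow> complex) set \<Rightarrow> real" where
  "L2_norm M F = sqrt (Re (L2_inner M F F))"

inductive_set L2_span ::
  "'b measure \<Rightarrow> ('b \<Rightarrow> complex) set set \<Rightarrow> ('b \<Rightarrow> complex) set set"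
  for M S where
    zero: "L2_zero M \<in> L2_span M S"
  | step: "F \<in> S \<Longrightarrow> G \<in> L2_span M S \<Longrightarrow> L2_add M (L2_scale M c F) G \<in> L2_span M S"

definition L2_closed_span ::
  "'b measure \<Rightarrow> ('b \<Rightarrow> complex) set set \<Rightarrow> ('b \<Rightarrow> complex) set set" where
  "L2_closed_span M S =
     {F \<in> L2 M. \<forall>e>0. \<exists>G\<in>L2_span M S. L2_norm M (L2_add M F (L2_scale M (-1) G)) < e}"


section \<open>Operators on \<open>L2 M\<close>\<close>

definition L2_linear ::
  "'b measure \<Rightarrow> (('b \<Rightarrow> complex) set \<Rightarrow> ('b \<Rightarrow> complex) set) \<Rightarrow> bool" where
  "L2_linear M T \<longleftrightarrow>
     (\<forall>F\<in>L2 M. T F \<in> L2 M) \<and>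
     (\<forall>F\<in>L2 M. \<forall>G\<in>L2 M. T (L2_add M F G) = L2_add M (T F) (T G)) \<and>
     (\<forall>c. \<forall>F\<in>L2 M. T (L2_scale M c F) = L2_scale M c (T F))"

definition L2_bounded ::
  "'b measure \<Rightarrow> (('b \<Rightarrow> complex) set \<Rightarrow> ('b \<Rightarrow> complex) set) \<Rightarrow> bool" where
  "L2_bounded M T \<longleftrightarrow>
     L2_linear M T \<and> (\<exists>C. \<forall>F\<in>L2 M. L2_norm M (T F) \<le> C * L2_norm M F)"

definition L2_unitary ::
  "'b measure \<Rightarrow> (('b \<Rightarrow> complex) set \<Rightarrow> ('b \<Rightarrow> complex) set) \<Rightarrow> bool" where
  "L2_unitary M T \<longleftrightarrow>
     L2_linear M T \<and> bij_betw T (L2 M) (L2 M) \<and>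
     (\<forall>F\<in>L2 M. \<forall>G\<in>L2 M. L2_inner M (T F) (T G) = L2_inner M F G)"

text \<open>
  Unital $*$-representations of $L^\infty(N)$ by bounded operators on $L^2(M)$; the first conjunct
  says that the operator depends only on the almost-everywhere class of the function.
\<close>

definition Linf_representation ::
  "'a measure \<Rightarrow> 'b measure \<Rightarrow>
   (('a \<Rightarrow> complex) \<Rightarrow> ('b \<Rightarrow> complex) set \<Rightarrow> ('b \<Rightarrow> complex) set) \<Rightarrow> bool" where
  "Linf_representation N M \<pi> \<longleftrightarrow>
     (\<forall>f\<in>Linf N. \<forall>g\<in>Linf N. (AE x in N. f x = g x) \<longrightarrow> (\<forall>F\<in>L2 M. \<pi> f F = \<pi> g F)) \<and>
     (\<forall>f\<in>Linf N. L2_bounded M (\<pi> f)) \<and>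
     (\<forall>f\<in>Linf N. \<forall>g\<in>Linf N. \<forall>F\<in>L2 M. \<pi> (\<lambda>x. f x + g x) F = L2_add M (\<pi> f F) (\<pi> g F)) \<and>
     (\<forall>c. \<forall>f\<in>Linf N. \<forall>F\<in>L2 M. \<pi> (\<lambda>x. c * f x) F = L2_scale M c (\<pi> f F)) \<and>
     (\<forall>f\<in>Linf N. \<forall>g\<in>Linf N. \<forall>F\<in>L2 M. \<pi> (\<lambda>x. f x * g x) F = \<pi> f (\<pi> g F)) \<and>
     (\<forall>F\<in>L2 M. \<pi> (\<lambda>_. 1) F = F) \<and>
     (\<forall>f\<in>Linf N. \<forall>F\<in>L2 M. \<forall>G\<in>L2 M.
        L2_inner M (\<pi> f F) G = L2_inner M F (\<pi> (\<lambda>x. cnj (f x)) G))"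

definition mult_op ::
  "'b measure \<Rightarrow> ('b \<Rightarrow> complex) \<Rightarrow> ('b \<Rightarrow> complex) set \<Rightarrow> ('b \<Rightarrow> complex) set" where
  "mult_op M g = ae_lift M (\<lambda>f x. g x * f x)"


section \<open>The map \<open>r\<close>, the filter and the transfer operator\<close>

definition strongly_invariant :: "('a \<Rightarrow> 'a) \<Rightarrow> 'a measure \<Rightarrow> bool" where
  "strongly_invariant r \<mu> \<longleftrightarrow>
     (\<forall>f\<in>Linf \<mu>. (\<integral>x. f x \<partial>\<mu>) = (\<integral>x. 1 / of_nat (card (r -` {x})) * (\<Sum>y\<in>r -` {x}. f y) \<partial>\<mu>))"

definition transfer_op :: "('a \<Rightarrow> 'a) \<Rightarrow> ('a \<Rightarrow> complex) \<Rightarrow> ('a \<Rightarrow> complex) \<Rightarrow> 'a \<Rightarrow> complex" where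
  "transfer_op r m\<^sub>0 \<xi> x =
     1 / of_nat (card (r -` {x})) * (\<Sum>y\<in>r -` {x}. of_real ((cmod (m\<^sub>0 y))\<^sup>2) * \<xi> y)"

definition nonsingular :: "'a measure \<Rightarrow> ('a \<Rightarrow> complex) \<Rightarrow> bool" where
  "nonsingular \<mu> m\<^sub>0 \<longleftrightarrow> \<not> (\<exists>A\<in>sets \<mu>. emeasure \<mu> A > 0 \<and> (\<forall>x\<in>A. m\<^sub>0 x = 0))"


section \<open>The solenoid\<close>

definition solenoid :: "('a \<Rightarrow> 'a) \<Rightarrow> (nat \<Rightarrow> 'a) set" where
  "solenoid r = {x. \<forall>n. r (x (Suc n)) = x n}"

definition \<theta> :: "nat \<Rightarrow> (nat \<Rightarrow> 'a) \<Rightarrow> 'a" where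
  "\<theta> n x = x n"

definition r_hat :: "('a \<Rightarrow> 'a) \<Rightarrow> (nat \<Rightarrow> 'a) \<Rightarrow> nat \<Rightarrow> 'a" where
  "r_hat r x = case_nat (r (x 0)) x"

definition solenoid_sets :: "('a::topological_space \<Rightarrow> 'a) \<Rightarrow> (nat \<Rightarrow> 'a) set set" where
  "solenoid_sets r =
     sigma_sets (solenoid r) {\<theta> n -` A \<inter> solenoid r | n A. A \<in> sets borel}"

text \<open>
  Finiteness is part of the defining property because the Bochner integral of a non-integrable
  function is 0: otherwise measures taking only the values 0 and $\infty$ would be admitted
  when $\int h\,d\mu = 0$.
\<close>

definition is_hat_measure ::
  "('a::topological_space \<Rightarrow> 'a) \<Rightarrow> 'a measure \<Rightarrow> ('a \<Rightarrow> complex) \<Rightarrow> ('a \<Rightarrow> real) \<Rightarrow>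
   (nat \<Rightarrow> 'a) measure \<Rightarrow> bool" where
  "is_hat_measure r \<mu> m\<^sub>0 h M \<longleftrightarrow>
     finite_measure M \<and> space M = solenoid r \<and> sets M = solenoid_sets r \<and>
     (\<forall>n. \<forall>f\<in>Linf \<mu>.
        (\<integral>x. (f \<circ> \<theta> n) x \<partial>M) =
        (\<integral>x. (transfer_op r m\<^sub>0 ^^ n) (\<lambda>y. f y * of_real (h y)) x \<partial>\<mu>))"


section \<open>The operators \<open>U\<close>, \<open>\<pi>\<close> and the vector \<open>\<phi>\<close>\<close>

definition cov_U ::
  "('a \<Rightarrow> 'a) \<Rightarrow> ('a \<Rightarrow> complex) \<Rightarrow> (nat \<Rightarrow> 'a) measure \<Rightarrow>
   ((nat \<Rightarrow> 'a) \<Rightarrow> complex) set \<Rightarrow> ((nat \<Rightarrow> 'a) \<Rightarrow> complex) set" where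
  "cov_U r m\<^sub>0 M = ae_lift M (\<lambda>f x. m\<^sub>0 (\<theta> 0 x) * f (r_hat r x))"

definition cov_pi ::
  "(nat \<Rightarrow> 'a) measure \<Rightarrow> ('a \<Rightarrow> complex) \<Rightarrow>
   ((nat \<Rightarrow> 'a) \<Rightarrow> complex) set \<Rightarrow> ((nat \<Rightarrow> 'a) \<Rightarrow> complex) set" where
  "cov_pi M g = mult_op M (g \<circ> \<theta> 0)"

definition cov_phi :: "(nat \<Rightarrow> 'a) measure \<Rightarrow> ((nat \<Rightarrow> 'a) \<Rightarrow> complex) set" where
  "cov_phi M = ae_class M (\<lambda>_. 1)"

end

(*
Strong invariance gives int R xi = int |m0|^2 xi, and R((g o r) xi) = g R xi holds pointwise.
Since theta_0 = r^n o theta_n, these identities and the defining property of the measure on the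
solenoid yield, for bounded f,

  int |m0 o theta_0|^2 (f o theta_n) = int f o theta_(n+1).

Cylinders form an intersection-stable generator, so the image under r_hat of the measure with
density |m0 o theta_0|^2 is the original measure. This makes U isometric, and dividing by m0,
which vanishes only on a null set, makes it onto. For the density of the span, U^n maps
1_A o theta_n to a bounded function of theta_0, so the span contains the indicators of all
cylinders; a Dynkin argument and simple functions do the rest.
*)
theory Submission
  imports Defs
begin

section \<open>Calculus of classes\<close>

text \<open>Two obstacles shape the proof. Strong invariance speaks only of essentially bounded
  functions, whereas \<open>h\<close> is merely integrable, so the iterates of the transfer operator
  are applied to unbounded functions. The invariance identity is therefore extended to all
  integrable functions by truncation: monotone convergence handles non-negative real functions, and
  their averages then dominate the complex case.

  The other obstacle is well-definedness on almost-everywhere classes. Preimages of null sets must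
  be null for \<open>r\<close>, for \<open>\<theta> 0\<close> and for \<open>r_hat r\<close>. For
  the last map this is a second use of non-singularity, beside surjectivity of \<open>U\<close>: the
  change of variables controls preimages only for the measure with density |m0 o theta_0|^2, and
  this has the null sets of the original measure because the density is positive almost
  everywhere.\<close>

definition sqint :: "'b measure \<Rightarrow> ('b \<Rightarrow> complex) set" where
  "sqint M = {f \<in> borel_measurable M. integrable M (\<lambda>x. (cmod (f x))\<^sup>2)}"

lemma borel_measurable_cnj:
  assumes "f \<in> borel_measurable M" shows "(\<lambda>x. cnj (f x)) \<in> borel_measurable M"
  using measurable_compose[OF assms borel_measurable_continuous_onI[OF continuous_on_cnj[OF continuous_on_id]]]
  by simp

lemma integral_indicator_complex:
  assumes "A \<in> sets M"
  shows "(\<integral>x. indicator A x \<partial>M) = complex_of_real (measure M A)"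
proof -
  have "(\<integral>x. indicator A x \<partial>M) = (\<integral>x. complex_of_real (indicator A x) \<partial>M)"
    by (simp add: of_real_indicator)
  then show ?thesis
    unfolding integral_complex_of_real using assms by (simp add: Int_absorb2 sets.sets_into_space)
qed

lemma sqint_measurable: "f \<in> sqint M \<Longrightarrow> f \<in> borel_measurable M"
  by (simp add: sqint_def)

lemma ae_class_self: "f \<in> borel_measurable M \<Longrightarrow> f \<in> ae_class M f"
  by (simp add: ae_class_def)

lemma ae_class_cong: "AE x in M. f x = g x \<Longrightarrow> ae_class M f = ae_class M g"
  unfolding ae_class_def by (auto elim: eventually_elim2)

lemma ae_class_eq_iff:
  assumes "f \<in> borel_measurable M"
  shows "ae_class M f = ae_class M g \<longleftrightarrow> (AE x in M. f x = g x)"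
  using ae_class_self[OF assms] ae_class_cong[of f g M] by (auto simp: ae_class_def)

lemma L2_eq: "L2 M = ae_class M ` sqint M"
  by (simp add: L2_def sqint_def)

lemma ae_class_in_L2: "f \<in> sqint M \<Longrightarrow> ae_class M f \<in> L2 M"
  by (simp add: L2_eq)

lemma L2_E:
  assumes "F \<in> L2 M" obtains f where "f \<in> sqint M" "F = ae_class M f"
  using assms by (auto simp: L2_eq)

text \<open>The union over representatives collapses to a single class once the operation respects
  almost-everywhere equality. The second hypothesis is thus the obligation that each concrete
  operator has to meet.\<close>

lemma ae_lift_class:
  assumes "f \<in> borel_measurable M"
    and "\<And>g. g \<in> borel_measurable M \<Longrightarrow> AE x in M. g x = f x \<Longrightarrow> AE x in M. T g x = T f x"
  shows "ae_lift M T (ae_class M f) = ae_class M (T f)"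
proof -
  have "ae_class M (T g) = ae_class M (T f)" if "g \<in> ae_class M f" for g
    using that assms(2) by (intro ae_class_cong) (auto simp: ae_class_def)
  then show ?thesis
    unfolding ae_lift_def using ae_class_self[OF assms(1)] by blast
qed

lemma mult_op_class:
  assumes "f \<in> borel_measurable M"
  shows "mult_op M g (ae_class M f) = ae_class M (\<lambda>x. g x * f x)"
  unfolding mult_op_def by (rule ae_lift_class[OF assms]) (auto elim: eventually_mono)

lemma L2_scale_class:
  assumes "f \<in> borel_measurable M"
  shows "L2_scale M c (ae_class M f) = ae_class M (\<lambda>x. c * f x)"
  unfolding L2_scale_def by (rule ae_lift_class[OF assms]) (auto elim: eventually_mono)

lemma L2_add_class:
  assumes "f \<in> borel_measurable M" "g \<in> borel_measurable M"
  shows "L2_add M (ae_class M f) (ae_class M g) = ae_class M (\<lambda>x. f x + g x)"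
proof -
  have "ae_class M (\<lambda>x. f' x + g' x) = ae_class M (\<lambda>x. f x + g x)"
    if "f' \<in> ae_class M f" "g' \<in> ae_class M g" for f' g'
    using that by (intro ae_class_cong) (auto simp: ae_class_def elim: eventually_elim2)
  then show ?thesis
    unfolding L2_add_def using ae_class_self[OF assms(1)] ae_class_self[OF assms(2)] by blast
qed

text \<open>Almost everywhere equal measurable integrands have the same Bochner integral, integrable
  or not, so the definite description in \<open>L2_inner\<close> has exactly one candidate.\<close>

lemma L2_inner_class:
  assumes [measurable]: "f \<in> borel_measurable M" "g \<in> borel_measurable M"
  shows "L2_inner M (ae_class M f) (ae_class M g) = (\<integral>x. cnj (f x) * g x \<partial>M)"
proof -
  have "(\<integral>x. cnj (f' x) * g' x \<partial>M) = (\<integral>x. cnj (f x) * g x \<partial>M)"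
    if "f' \<in> ae_class M f" "g' \<in> ae_class M g" for f' g'
  proof (rule integral_cong_AE)
    have m [measurable]: "f' \<in> borel_measurable M" "g' \<in> borel_measurable M"
      using that by (auto simp: ae_class_def)
    show "(\<lambda>x. cnj (f' x) * g' x) \<in> borel_measurable M"
      and "(\<lambda>x. cnj (f x) * g x) \<in> borel_measurable M"
      by (intro borel_measurable_times borel_measurable_cnj m assms)+
    show "AE x in M. cnj (f' x) * g' x = cnj (f x) * g x"
      using that by (auto simp: ae_class_def elim: eventually_elim2)
  qed
  note * = this
  show ?thesis
    unfolding L2_inner_def
    by (rule the_equality, intro ballI)
      (rule *[symmetric], assumption+, use ae_class_self[OF assms(1)] ae_class_self[OF assms(2)] in blast)
qed

lemma L2_norm_class:
  assumes "f \<in> borel_measurable M"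
  shows "L2_norm M (ae_class M f) = sqrt (\<integral>x. (cmod (f x))\<^sup>2 \<partial>M)"
proof -
  have "(\<integral>x. cnj (f x) * f x \<partial>M) = (\<integral>x. of_real ((cmod (f x))\<^sup>2) \<partial>M)"
    by (rule Bochner_Integration.integral_cong) (simp_all only: complex_norm_square mult.commute)
  then show ?thesis
    by (simp add: L2_norm_def L2_inner_class[OF assms assms] del: of_real_power)
qed

text \<open>Takes the place of Minkowski's inequality, so that squared distances can be estimated
  without roots. The factor 2 is harmless, since later only smallness of the distances
  matters.\<close>

lemma cmod_add_square_le: "(cmod (a + b))\<^sup>2 \<le> 2 * ((cmod a)\<^sup>2 + (cmod b)\<^sup>2)"
proof -
  have "(cmod (a + b))\<^sup>2 \<le> (cmod a + cmod b)\<^sup>2"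
    by (intro power_mono norm_triangle_ineq) simp
  also have "\<dots> \<le> 2 * ((cmod a)\<^sup>2 + (cmod b)\<^sup>2)"
    using sum_squares_bound[of "cmod a" "cmod b"] by (simp add: power2_sum)
  finally show ?thesis .
qed

lemma sqint_add:
  assumes "f \<in> sqint M" "g \<in> sqint M" shows "(\<lambda>x. f x + g x) \<in> sqint M"
proof -
  have [measurable]: "f \<in> borel_measurable M" "g \<in> borel_measurable M"
    using assms by (auto simp: sqint_def)
  have "integrable M (\<lambda>x. (cmod (f x + g x))\<^sup>2)"
    by (rule Bochner_Integration.integrable_bound
        [where f = "\<lambda>x. 2 * ((cmod (f x))\<^sup>2 + (cmod (g x))\<^sup>2)"])
      (use assms cmod_add_square_le in \<open>auto simp: sqint_def\<close>)
  then show ?thesis by (simp add: sqint_def)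
qed

lemma sqint_integral_add_le:
  assumes "f \<in> sqint M" "g \<in> sqint M"
  shows "(\<integral>x. (cmod (f x + g x))\<^sup>2 \<partial>M)
    \<le> 2 * ((\<integral>x. (cmod (f x))\<^sup>2 \<partial>M) + (\<integral>x. (cmod (g x))\<^sup>2 \<partial>M))"
proof -
  have "(\<integral>x. (cmod (f x + g x))\<^sup>2 \<partial>M) \<le> (\<integral>x. 2 * ((cmod (f x))\<^sup>2 + (cmod (g x))\<^sup>2) \<partial>M)"
    using assms sqint_add[OF assms] cmod_add_square_le by (intro integral_mono) (auto simp: sqint_def)
  then show ?thesis using assms by (simp add: sqint_def)
qed

lemma Linf_mult_sqint:
  assumes "g \<in> Linf M"
  shows "f \<in> sqint M \<Longrightarrow> (\<lambda>x. g x * f x) \<in> sqint M"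
    and "\<exists>C\<ge>0. \<forall>f\<in>sqint M.
      sqrt (\<integral>x. (cmod (g x * f x))\<^sup>2 \<partial>M) \<le> C * sqrt (\<integral>x. (cmod (f x))\<^sup>2 \<partial>M)"
proof -
  obtain C0 where C0: "AE x in M. cmod (g x) \<le> C0" and [measurable]: "g \<in> borel_measurable M"
    using assms by (auto simp: Linf_def)
  \<comment> \<open>On a null measure the essential bound may be negative; squaring it monotonically
    requires a non-negative constant.\<close>
  define C where "C = max C0 0"
  have "0 \<le> C" and C: "AE x in M. cmod (g x) \<le> C"
    using C0 by (auto simp: C_def elim: eventually_mono)
  have bound: "AE x in M. (cmod (g x * f x))\<^sup>2 \<le> C\<^sup>2 * (cmod (f x))\<^sup>2" for f
    using C by eventually_elim (auto simp: norm_mult power_mult_distrib intro!: mult_right_mono power_mono)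
  have sq: "(\<lambda>x. g x * f x) \<in> sqint M" if "f \<in> sqint M" for f
  proof -
    have [measurable]: "f \<in> borel_measurable M" using that by (simp add: sqint_def)
    have "integrable M (\<lambda>x. (cmod (g x * f x))\<^sup>2)"
      by (rule Bochner_Integration.integrable_bound[where f = "\<lambda>x. C\<^sup>2 * (cmod (f x))\<^sup>2"])
        (use that bound[of f] in \<open>auto simp: sqint_def\<close>)
    then show ?thesis by (simp add: sqint_def)
  qed
  show "f \<in> sqint M \<Longrightarrow> (\<lambda>x. g x * f x) \<in> sqint M" using sq by simp
  show "\<exists>C\<ge>0. \<forall>f\<in>sqint M.
      sqrt (\<integral>x. (cmod (g x * f x))\<^sup>2 \<partial>M) \<le> C * sqrt (\<integral>x. (cmod (f x))\<^sup>2 \<partial>M)"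
  proof (intro exI[of _ C] conjI ballI)
    fix f assume f: "f \<in> sqint M"
    have "(\<integral>x. (cmod (g x * f x))\<^sup>2 \<partial>M) \<le> (\<integral>x. C\<^sup>2 * (cmod (f x))\<^sup>2 \<partial>M)"
      using f sq[OF f] bound[of f] by (intro integral_mono_AE) (auto simp: sqint_def)
    also have "\<dots> = C\<^sup>2 * (\<integral>x. (cmod (f x))\<^sup>2 \<partial>M)" by simp
    finally show "sqrt (\<integral>x. (cmod (g x * f x))\<^sup>2 \<partial>M) \<le> C * sqrt (\<integral>x. (cmod (f x))\<^sup>2 \<partial>M)"
      using \<open>0 \<le> C\<close> real_sqrt_le_mono by (fastforce simp: real_sqrt_mult)
  qed fact
qed

section \<open>Closure properties of essentially bounded functions\<close>

lemma Linf_measurable: "f \<in> Linf M \<Longrightarrow> f \<in> borel_measurable M"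
  by (simp add: Linf_def)

lemma Linf_const: "(\<lambda>_. c) \<in> Linf M"
  by (auto simp: Linf_def)

lemma Linf_mult:
  assumes "f \<in> Linf M" "g \<in> Linf M" shows "(\<lambda>x. f x * g x) \<in> Linf M"
proof -
  obtain C D where "AE x in M. cmod (f x) \<le> C" "AE x in M. cmod (g x) \<le> D"
    using assms by (auto simp: Linf_def)
  then have "AE x in M. cmod (f x * g x) \<le> max C 0 * max D 0"
    by eventually_elim (auto simp: norm_mult intro!: mult_mono)
  then show ?thesis using assms by (auto simp: Linf_def)
qed

lemma Linf_add:
  assumes "f \<in> Linf M" "g \<in> Linf M" shows "(\<lambda>x. f x + g x) \<in> Linf M"
proof -
  obtain C D where "AE x in M. cmod (f x) \<le> C" "AE x in M. cmod (g x) \<le> D"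
    using assms by (auto simp: Linf_def)
  then have "AE x in M. cmod (f x + g x) \<le> C + D"
    by eventually_elim (rule norm_triangle_mono)
  then show ?thesis using assms by (auto simp: Linf_def)
qed

lemma Linf_cnj: "f \<in> Linf M \<Longrightarrow> (\<lambda>x. cnj (f x)) \<in> Linf M"
  by (auto simp: Linf_def borel_measurable_cnj)

lemma Linf_indicator: "A \<in> sets M \<Longrightarrow> (indicator A :: _ \<Rightarrow> complex) \<in> Linf M"
  by (auto simp: Linf_def indicator_def intro!: exI[of _ 1])

text \<open>The last hypothesis says that preimages of null sets are null, which lets an essential
  bound survive composition. It is verified below for \<open>r\<close>, \<open>\<theta> 0\<close>
  and \<open>r_hat r\<close>.\<close>

lemma Linf_comp_nonsingular:
  assumes "f \<in> Linf N" "T \<in> measurable M N"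
    and "\<And>P. AE x in N. P x \<Longrightarrow> AE x in M. P (T x)"
  shows "f \<circ> T \<in> Linf M"
  using assms unfolding Linf_def comp_def by fastforce

lemma integrable_Linf: "finite_measure M \<Longrightarrow> f \<in> Linf M \<Longrightarrow> integrable M f"
  using finite_measure.integrable_const_bound by (auto simp: Linf_def)

lemma Linf_mult_integrable:
  assumes "f \<in> Linf M" "integrable M \<xi>" shows "integrable M (\<lambda>x. f x * \<xi> x :: complex)"
proof -
  obtain C where C: "AE x in M. cmod (f x) \<le> C" and f: "f \<in> borel_measurable M"
    using assms(1) by (auto simp: Linf_def)
  show ?thesis
  proof (rule Bochner_Integration.integrable_bound[where f = "\<lambda>x. C * norm (\<xi> x)"])
    show "AE x in M. norm (f x * \<xi> x) \<le> norm (C * norm (\<xi> x))"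
      using C by eventually_elim
        (auto simp: norm_mult abs_mult intro!: mult_right_mono order_trans[OF _ abs_ge_self])
  qed (use assms(2) f borel_measurable_integrable[OF assms(2)] in \<open>auto intro!: borel_measurable_times\<close>)
qed

lemma sqint_scale: "f \<in> sqint M \<Longrightarrow> (\<lambda>x. c * f x) \<in> sqint M"
  using Linf_mult_sqint(1)[OF Linf_const] .

section \<open>Multiplication operators\<close>

lemma mult_op_L2_bounded:
  assumes g: "g \<in> Linf M" shows "L2_bounded M (mult_op M g)"
proof -
  note [simp] = mult_op_class L2_add_class L2_scale_class sqint_measurable ae_class_in_L2
    sqint_add sqint_scale Linf_mult_sqint(1)[OF g]
  have "L2_linear M (mult_op M g)"
    unfolding L2_linear_def
  proof (intro conjI allI ballI)
    fix F assume "F \<in> L2 M"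
    then obtain f where f: "f \<in> sqint M" "F = ae_class M f" by (rule L2_E)
    show "mult_op M g F \<in> L2 M" using f by simp
    show "mult_op M g (L2_scale M c F) = L2_scale M c (mult_op M g F)" for c
      using f by (simp add: mult.left_commute)
    fix G assume "G \<in> L2 M"
    then obtain k where k: "k \<in> sqint M" "G = ae_class M k" by (rule L2_E)
    show "mult_op M g (L2_add M F G) = L2_add M (mult_op M g F) (mult_op M g G)"
      using f k by (simp add: distrib_left)
  qed
  moreover obtain C where "\<And>f. f \<in> sqint M \<Longrightarrow>
      sqrt (\<integral>x. (cmod (g x * f x))\<^sup>2 \<partial>M) \<le> C * sqrt (\<integral>x. (cmod (f x))\<^sup>2 \<partial>M)"
    using Linf_mult_sqint(2)[OF g] by blast
  then have "\<forall>F\<in>L2 M. L2_norm M (mult_op M g F) \<le> C * L2_norm M F"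
    by (auto elim!: L2_E simp: L2_norm_class)
  ultimately show ?thesis unfolding L2_bounded_def by blast
qed

text \<open>Pulling back along \<open>T = \<theta> 0\<close> gives \<open>cov_pi\<close>.
  Preservation of null sets under preimages is what makes the operator depend on the class of
  \<open>g\<close> only; the algebraic laws are pointwise.\<close>

lemma mult_op_Linf_representation:
  assumes T: "T \<in> measurable M N"
    and nonsing: "\<And>P. AE x in N. P x \<Longrightarrow> AE x in M. P (T x)"
  shows "Linf_representation N M (\<lambda>g. mult_op M (g \<circ> T))"
proof -
  have inf: "g \<circ> T \<in> Linf M" if "g \<in> Linf N" for g
    by (rule Linf_comp_nonsingular[OF that T nonsing])
  have sq: "(\<lambda>x. g (T x) * f x) \<in> sqint M" if "g \<in> Linf N" "f \<in> sqint M" for f g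
    using Linf_mult_sqint(1)[OF inf[OF that(1)] that(2)] by simp
  note [simp] = mult_op_class L2_add_class L2_scale_class sqint_measurable L2_inner_class sq Linf_cnj
  show ?thesis
    unfolding Linf_representation_def
  proof (intro conjI allI ballI impI)
    fix f F assume f: "f \<in> Linf N" and "F \<in> L2 M"
    then obtain k where k: "k \<in> sqint M" "F = ae_class M k" by (auto elim: L2_E)
    show "mult_op M ((\<lambda>x. c * f x) \<circ> T) F = L2_scale M c (mult_op M (f \<circ> T) F)" for c
      using f k by (simp add: mult.assoc)
    show "mult_op M (f \<circ> T) F = mult_op M (g \<circ> T) F" if "AE x in N. f x = g x" for g
    proof -
      have "AE x in M. f (T x) * k x = g (T x) * k x"
        using nonsing[OF that] by eventually_elim simp
      then show ?thesis using k f by (simp add: ae_class_cong)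
    qed
    fix g assume g: "g \<in> Linf N"
    show "mult_op M ((\<lambda>x. f x + g x) \<circ> T) F = L2_add M (mult_op M (f \<circ> T) F) (mult_op M (g \<circ> T) F)"
      using f g k by (simp add: distrib_right)
    show "mult_op M ((\<lambda>x. f x * g x) \<circ> T) F = mult_op M (f \<circ> T) (mult_op M (g \<circ> T) F)"
      using f g k by (simp add: mult.assoc)
  next
    fix f F G assume f: "f \<in> Linf N" and "F \<in> L2 M" "G \<in> L2 M"
    then obtain k l where k: "k \<in> sqint M" "F = ae_class M k" and l: "l \<in> sqint M" "G = ae_class M l"
      by (auto elim!: L2_E)
    show "L2_inner M (mult_op M (f \<circ> T) F) G = L2_inner M F (mult_op M ((\<lambda>x. cnj (f x)) \<circ> T) G)"
      using f k l sq[OF Linf_cnj[OF f] l(1)] by (simp add: mult.assoc mult.left_commute)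
  next
    fix F assume "F \<in> L2 M"
    then show "mult_op M ((\<lambda>_. 1) \<circ> T) F = F" by (auto elim!: L2_E)
  qed (simp add: inf mult_op_L2_bounded)
qed

section \<open>Total sets in \<open>L2 M\<close>\<close>

lemma sqint_diff:
  assumes "f \<in> sqint M" "g \<in> sqint M" shows "(\<lambda>x. f x - g x) \<in> sqint M"
  using sqint_add[OF assms(1) sqint_scale[OF assms(2), of "-1"]] by simp

lemma sqint_cong_AE:
  assumes "f \<in> sqint M" "g \<in> borel_measurable M" "AE x in M. f x = g x"
  shows "g \<in> sqint M"
proof -
  have [measurable]: "f \<in> borel_measurable M" "g \<in> borel_measurable M"
    using assms by (auto simp: sqint_def)
  have "integrable M (\<lambda>x. (cmod (f x))\<^sup>2) \<longleftrightarrow> integrable M (\<lambda>x. (cmod (g x))\<^sup>2)"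
    by (rule integrable_cong_AE) (use assms(3) in auto)
  then show ?thesis using assms by (simp add: sqint_def)
qed

lemma L2_span_subset:
  assumes "S \<subseteq> L2 M" "F \<in> L2_span M S" shows "F \<in> L2 M"
  using assms(2)
proof induction
  case zero
  show ?case unfolding L2_zero_def by (rule ae_class_in_L2) (simp add: sqint_def)
next
  case (step F G c)
  then have "F \<in> L2 M" "G \<in> L2 M" using assms(1) by auto
  then obtain f g where "f \<in> sqint M" "F = ae_class M f" "g \<in> sqint M" "G = ae_class M g"
    by (auto elim!: L2_E)
  then show ?case
    by (simp add: L2_scale_class L2_add_class sqint_measurable sqint_scale ae_class_in_L2 sqint_add)
qed

lemma L2_span_base:
  assumes "S \<subseteq> L2 M" "F \<in> S" shows "F \<in> L2_span M S"
proof -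
  obtain f where f: "f \<in> sqint M" "F = ae_class M f" using assms by (auto elim: L2_E)
  have "L2_add M (L2_scale M 1 F) (L2_zero M) \<in> L2_span M S"
    by (intro L2_span.intros assms)
  then show ?thesis
    using f by (simp add: L2_scale_class L2_zero_def L2_add_class sqint_measurable)
qed

text \<open>The span grows by one scaled generator at a time, so closure under linear combinations
  is an induction over the left summand, with the outer scalar absorbed into that of the
  generator.\<close>

lemma L2_span_add_scale:
  assumes S: "S \<subseteq> L2 M" and F: "F \<in> L2_span M S" and G: "G \<in> L2_span M S"
  shows "L2_add M (L2_scale M c F) G \<in> L2_span M S"
  using F
proof induction
  case zero
  obtain g where "g \<in> sqint M" "G = ae_class M g" using L2_span_subset[OF S G] by (rule L2_E)
  then show ?case
    using G by (simp add: L2_zero_def L2_scale_class L2_add_class sqint_measurable)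
next
  case (step F H d)
  have "F \<in> L2 M" "H \<in> L2 M" "G \<in> L2 M" using step S G L2_span_subset by auto
  then obtain f h g where fhg: "f \<in> sqint M" "F = ae_class M f" "h \<in> sqint M" "H = ae_class M h"
    "g \<in> sqint M" "G = ae_class M g"
    by (auto elim!: L2_E)
  have "L2_add M (L2_scale M c (L2_add M (L2_scale M d F) H)) G
    = L2_add M (L2_scale M (c * d) F) (L2_add M (L2_scale M c H) G)"
    using fhg by (simp add: L2_scale_class L2_add_class sqint_measurable sqint_scale sqint_add algebra_simps)
  then show ?case using L2_span.step[OF step.hyps(1) step.IH] by simp
qed

text \<open>Counterpart of the closed span on the level of functions, measured by squared distances,
  so that limit theorems for integrals apply directly.\<close>

definition L2_approximable :: "'b measure \<Rightarrow> ('b \<Rightarrow> complex) set set \<Rightarrow> ('b \<Rightarrow> complex) set" where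
  "L2_approximable M S = {f \<in> sqint M. \<forall>e>0. \<exists>g\<in>sqint M. ae_class M g \<in> L2_span M S \<and>
     (\<integral>x. (cmod (f x - g x))\<^sup>2 \<partial>M) < e}"

lemma L2_approximable_closed_span:
  assumes "f \<in> L2_approximable M S"
  shows "ae_class M f \<in> L2_closed_span M S"
proof -
  have f: "f \<in> sqint M" using assms by (simp add: L2_approximable_def)
  have "\<exists>G\<in>L2_span M S. L2_norm M (L2_add M (ae_class M f) (L2_scale M (-1) G)) < e"
    if "e > 0" for e
  proof -
    have "e\<^sup>2 > 0" using that by simp
    then obtain g where g: "g \<in> sqint M" "ae_class M g \<in> L2_span M S"
      "(\<integral>x. (cmod (f x - g x))\<^sup>2 \<partial>M) < e\<^sup>2"
      using assms unfolding L2_approximable_def by blast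
    have "sqrt (\<integral>x. (cmod (f x - g x))\<^sup>2 \<partial>M) < e"
      using g(3) that by (auto intro: real_less_lsqrt)
    then have "L2_norm M (L2_add M (ae_class M f) (L2_scale M (-1) (ae_class M g))) < e"
      using f g sqint_scale[OF g(1), of "-1"] sqint_diff[OF f g(1)]
      by (simp add: L2_scale_class L2_add_class sqint_measurable L2_norm_class)
    then show ?thesis using g(2) by blast
  qed
  then show ?thesis using ae_class_in_L2[OF f] by (simp add: L2_closed_span_def)
qed

lemma L2_approximable_limit:
  assumes "f \<in> sqint M"
    and "\<And>e. e > 0 \<Longrightarrow> \<exists>k\<in>L2_approximable M S. (\<integral>x. (cmod (f x - k x))\<^sup>2 \<partial>M) < e"
  shows "f \<in> L2_approximable M S"
  unfolding L2_approximable_def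
proof (intro CollectI conjI allI impI)
  fix e :: real assume "e > 0"
  \<comment> \<open>Both errors are taken below \<open>e / 4\<close> because
    \<open>sqint_integral_add_le\<close> doubles their sum.\<close>
  then obtain k where k: "k \<in> L2_approximable M S" "(\<integral>x. (cmod (f x - k x))\<^sup>2 \<partial>M) < e / 4"
    using assms(2)[of "e / 4"] by auto
  then obtain g where g: "g \<in> sqint M" "ae_class M g \<in> L2_span M S"
    "(\<integral>x. (cmod (k x - g x))\<^sup>2 \<partial>M) < e / 4"
    using \<open>e > 0\<close> unfolding L2_approximable_def by (auto dest!: spec[of _ "e / 4"])
  have ks: "k \<in> sqint M" using k(1) by (simp add: L2_approximable_def)
  have "(\<integral>x. (cmod (f x - g x))\<^sup>2 \<partial>M) < e"
    using sqint_integral_add_le[OF sqint_diff[OF assms(1) ks] sqint_diff[OF ks g(1)]] k(2) g(3)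
    by simp
  then show "\<exists>g\<in>sqint M. ae_class M g \<in> L2_span M S \<and> (\<integral>x. (cmod (f x - g x))\<^sup>2 \<partial>M) < e"
    using g by blast
qed fact

lemma L2_approximable_span:
  assumes "f \<in> sqint M" "ae_class M f \<in> L2_span M S" shows "f \<in> L2_approximable M S"
  using assms unfolding L2_approximable_def by (auto intro!: bexI[of _ f])

lemma L2_approximable_cong_AE:
  assumes f: "f \<in> L2_approximable M S" and g: "g \<in> borel_measurable M" and eq: "AE x in M. f x = g x"
  shows "g \<in> L2_approximable M S"
proof (rule L2_approximable_limit)
  show "g \<in> sqint M" using sqint_cong_AE[OF _ g eq] f by (simp add: L2_approximable_def)
  have "(\<integral>x. (cmod (g x - f x))\<^sup>2 \<partial>M) = 0"
    by (rule integral_eq_zero_AE) (use eq in \<open>auto elim: eventually_mono\<close>)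
  then show "\<exists>k\<in>L2_approximable M S. (\<integral>x. (cmod (g x - k x))\<^sup>2 \<partial>M) < e" if "e > 0" for e
    using f that by (auto intro!: bexI[of _ f])
qed

lemma L2_approximable_add_scale:
  assumes S: "S \<subseteq> L2 M" and f: "f \<in> L2_approximable M S" and g: "g \<in> L2_approximable M S"
  shows "(\<lambda>x. c * f x + g x) \<in> L2_approximable M S"
  unfolding L2_approximable_def
proof (intro CollectI conjI allI impI)
  have sq: "f \<in> sqint M" "g \<in> sqint M" using f g by (auto simp: L2_approximable_def)
  then show "(\<lambda>x. c * f x + g x) \<in> sqint M" by (intro sqint_add sqint_scale)
  fix e :: real assume e: "e > 0"
  \<comment> \<open>The total error will be at most \<open>2 * ((cmod c)\<^sup>2 * d + d)\<close>,
    which this choice makes \<open>e / 2\<close>.\<close>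
  define d where "d = e / (4 * ((cmod c)\<^sup>2 + 1))"
  have "(cmod c)\<^sup>2 + 1 > 0" by (simp add: add_nonneg_pos)
  then have d: "d > 0" "((cmod c)\<^sup>2 + 1) * d = e / 4"
    using e by (simp_all add: d_def divide_simps)
  obtain k where k: "k \<in> sqint M" "ae_class M k \<in> L2_span M S" "(\<integral>x. (cmod (f x - k x))\<^sup>2 \<partial>M) < d"
    using f d(1) unfolding L2_approximable_def by blast
  obtain l where l: "l \<in> sqint M" "ae_class M l \<in> L2_span M S" "(\<integral>x. (cmod (g x - l x))\<^sup>2 \<partial>M) < d"
    using g d(1) unfolding L2_approximable_def by blast
  have "(\<integral>x. (cmod (c * f x + g x - (c * k x + l x)))\<^sup>2 \<partial>M)
    = (\<integral>x. (cmod (c * (f x - k x) + (g x - l x)))\<^sup>2 \<partial>M)"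
    by (simp add: algebra_simps)
  also have "\<dots> \<le> 2 * ((\<integral>x. (cmod (c * (f x - k x)))\<^sup>2 \<partial>M) + (\<integral>x. (cmod (g x - l x))\<^sup>2 \<partial>M))"
    by (intro sqint_integral_add_le sqint_scale sqint_diff sq k l)
  also have "(\<integral>x. (cmod (c * (f x - k x)))\<^sup>2 \<partial>M) = (cmod c)\<^sup>2 * (\<integral>x. (cmod (f x - k x))\<^sup>2 \<partial>M)"
    by (simp add: norm_mult power_mult_distrib)
  also have "\<dots> \<le> (cmod c)\<^sup>2 * d" using k(3) by (intro mult_left_mono) auto
  finally have "(\<integral>x. (cmod (c * f x + g x - (c * k x + l x)))\<^sup>2 \<partial>M) \<le> 2 * ((cmod c)\<^sup>2 * d + d)"
    using l(3) by simp
  then have "(\<integral>x. (cmod (c * f x + g x - (c * k x + l x)))\<^sup>2 \<partial>M) < e"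
    using d e by (simp add: distrib_right)
  moreover have "ae_class M (\<lambda>x. c * k x + l x) \<in> L2_span M S"
    using L2_span_add_scale[OF S k(2) l(2), of c] k(1) l(1) sqint_scale[OF k(1), of c]
    by (simp add: L2_scale_class L2_add_class sqint_measurable)
  moreover have "(\<lambda>x. c * k x + l x) \<in> sqint M" by (intro sqint_add sqint_scale k l)
  ultimately show "\<exists>q\<in>sqint M. ae_class M q \<in> L2_span M S \<and>
      (\<integral>x. (cmod (c * f x + g x - q x))\<^sup>2 \<partial>M) < e"
    by (intro bexI[of _ "\<lambda>x. c * k x + l x"]) auto
qed

lemma L2_approximable_zero: "(\<lambda>_. 0) \<in> L2_approximable M S"
  by (rule L2_approximable_span) (use L2_span.zero in \<open>auto simp: sqint_def L2_zero_def\<close>)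

lemma L2_approximable_sum:
  assumes "S \<subseteq> L2 M" "finite I" "\<And>i. i \<in> I \<Longrightarrow> f i \<in> L2_approximable M S"
  shows "(\<lambda>x. \<Sum>i\<in>I. c i * f i x) \<in> L2_approximable M S"
  using assms(2,3)
  by (induction) (simp_all add: L2_approximable_zero L2_approximable_add_scale[OF assms(1)])

section \<open>Density from an intersection-stable generator\<close>

context finite_measure
begin

lemma indicator_sqint: "A \<in> sets M \<Longrightarrow> indicator A \<in> sqint M"
  using Linf_mult_sqint(1)[OF Linf_indicator, of A M "\<lambda>_. 1"]
  by (simp add: sqint_def)

text \<open>Complements are differences against the indicator of the whole space, whence the
  hypothesis \<open>space M \<in> E\<close>. A disjoint union is the limit of finite sums of
  indicators: the squared distance is the measure of the remaining tail, which tends to 0 because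
  the measure is finite.\<close>

lemma L2_approximable_indicator:
  assumes S: "S \<subseteq> L2 M" and E: "Int_stable E" "E \<subseteq> Pow (space M)" "space M \<in> E"
    and sets_M: "sets M = sigma_sets (space M) E"
    and ind: "\<And>A. A \<in> E \<Longrightarrow> ae_class M (indicator A) \<in> S"
    and A: "A \<in> sets M"
  shows "indicator A \<in> L2_approximable M S"
proof -
  have E_sets: "B \<in> sets M" if "B \<in> E" for B using that sets_M by (auto intro: sigma_sets.Basic)
  have base: "indicator B \<in> L2_approximable M S" if "B \<in> E" for B
    using L2_approximable_span[OF indicator_sqint[OF E_sets[OF that]]]
      L2_span_base[OF S ind[OF that]] by simp
  have "A \<in> sigma_sets (space M) E" using A sets_M by simp
  from E(1,2) this show ?thesis
  proof (induction rule: sigma_sets_induct_disjoint)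
    case (basic B) then show ?case by (rule base)
  next
    case empty
    then show ?case using L2_approximable_zero[of M S] by (simp add: indicator_def[abs_def])
  next
    case (compl B)
    have "(\<lambda>x. (-1) * indicator B x + indicator (space M) x) \<in> L2_approximable M S"
      by (rule L2_approximable_add_scale[OF S compl(2) base[OF E(3)]])
    moreover have "indicator (space M - B) \<in> borel_measurable M"
      using compl(1) sets_M by (intro borel_measurable_indicator) auto
    ultimately show ?case
      by (rule L2_approximable_cong_AE) (auto simp: indicator_def)
  next
    case (union B)
    define V where "V n = (\<Union>i<n. B i)" for n
    have B: "B i \<in> sets M" for i using union(2) sets_M by auto
    have V: "V n \<in> sets M" for n using B by (auto simp: V_def)
    have V_approx: "indicator (V n) \<in> L2_approximable M S" for n
    proof -
      have "(\<lambda>x. \<Sum>i<n. 1 * indicator (B i) x) \<in> L2_approximable M S"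
        using union(3) by (intro L2_approximable_sum S) auto
      moreover have "(\<Sum>i<n. indicator (B i) x) = (indicator (V n) x :: complex)" for x
        unfolding V_def
        using union(1) by (intro indicator_UN_disjoint[symmetric]) (auto simp: disjoint_family_on_def)
      ultimately show ?thesis by simp
    qed
    have lim: "(\<lambda>n. measure M (V n)) \<longlonglongrightarrow> measure M (\<Union>n. V n)"
      using V by (intro finite_Lim_measure_incseq) (auto simp: V_def incseq_def intro: less_le_trans)
    have UV: "(\<Union>n. V n) = (\<Union>i. B i)" by (auto simp: V_def)
    have diff: "(\<integral>x. (cmod (indicator (\<Union>i. B i) x - indicator (V n) x))\<^sup>2 \<partial>M)
      = measure M (\<Union>i. B i) - measure M (V n)" for n
    proof -
      have "(\<integral>x. (cmod (indicator (\<Union>i. B i) x - indicator (V n) x))\<^sup>2 \<partial>M)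
        = (\<integral>x. indicator ((\<Union>i. B i) - V n) x \<partial>M)"
        by (rule Bochner_Integration.integral_cong) (auto simp: indicator_def V_def)
      also have "\<dots> = measure M ((\<Union>i. B i) - V n)"
        using B V by (simp add: Int_absorb2 sets.sets_into_space)
      also have "\<dots> = measure M (\<Union>i. B i) - measure M (V n)"
        using B V by (intro finite_measure_Diff) (auto simp: V_def)
      finally show ?thesis .
    qed
    show ?case
    proof (rule L2_approximable_limit)
      show "indicator (\<Union>i. B i) \<in> sqint M" using B by (intro indicator_sqint) auto
      fix e :: real assume "e > 0"
      then have "\<forall>\<^sub>F n in sequentially. measure M (V n) > measure M (\<Union>i. B i) - e"
        using lim unfolding UV by (intro order_tendstoD(1)) auto
      then obtain n where "measure M (\<Union>i. B i) - measure M (V n) < e"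
        by (auto simp: eventually_sequentially algebra_simps)
      then show "\<exists>k\<in>L2_approximable M S. (\<integral>x. (cmod (indicator (\<Union>i. B i) x - k x))\<^sup>2 \<partial>M) < e"
        using V_approx diff by (intro bexI[of _ "indicator (V n)"]) auto
    qed
  qed
qed

lemma L2_closed_span_eq_L2:
  assumes S: "S \<subseteq> L2 M" and E: "Int_stable E" "E \<subseteq> Pow (space M)" "space M \<in> E"
    and sets_M: "sets M = sigma_sets (space M) E"
    and ind: "\<And>A. A \<in> E \<Longrightarrow> ae_class M (indicator A) \<in> S"
  shows "L2_closed_span M S = L2 M"
proof
  show "L2_closed_span M S \<subseteq> L2 M" by (auto simp: L2_closed_span_def)
  show "L2 M \<subseteq> L2_closed_span M S"
  proof
    fix F assume "F \<in> L2 M"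
    then obtain f where f: "f \<in> sqint M" "F = ae_class M f" by (rule L2_E)
    have [measurable]: "f \<in> borel_measurable M" using f by (simp add: sqint_def)
    obtain s where s: "\<And>i. simple_function M (s i)"
      and lim: "\<And>x. x \<in> space M \<Longrightarrow> (\<lambda>i. s i x) \<longlonglongrightarrow> f x"
      and bound: "\<And>i x. x \<in> space M \<Longrightarrow> dist (s i x) 0 \<le> 2 * dist (f x) 0"
      using borel_measurable_implies_sequence_metric[of f M 0, OF \<open>f \<in> borel_measurable M\<close>] by blast
    have [measurable]: "s i \<in> borel_measurable M" for i
      using s by (rule borel_measurable_simple_function)
    have s_approx: "s i \<in> L2_approximable M S" for i
    proof -
      have fin: "finite (s i ` space M)" and meas: "s i -` {y} \<inter> space M \<in> sets M" for y
        using s[of i] by (auto intro: simple_functionD)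
      have "(\<lambda>x. \<Sum>y\<in>s i ` space M. y * indicator (s i -` {y} \<inter> space M) x) \<in> L2_approximable M S"
        using L2_approximable_indicator[OF S E sets_M ind] meas
        by (intro L2_approximable_sum S fin) auto
      moreover have "(\<Sum>y\<in>s i ` space M. y * indicator (s i -` {y} \<inter> space M) x) = s i x"
        if "x \<in> space M" for x
        using that fin by (simp add: indicator_def if_distrib[of "times _"] sum.delta' cong: if_cong)
      ultimately show ?thesis
        using L2_approximable_cong_AE[OF _ \<open>s i \<in> borel_measurable M\<close>] by auto
    qed
    have "f \<in> L2_approximable M S"
    proof (rule L2_approximable_limit[OF f(1)])
      \<comment> \<open>The dominating constant 9 is the square of 1 + 2, since the modulus of
        \<open>s i\<close> is at most twice that of \<open>f\<close>.\<close>
      have "(\<lambda>i. \<integral>x. (cmod (f x - s i x))\<^sup>2 \<partial>M) \<longlonglongrightarrow> (\<integral>x. 0 \<partial>M)"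
      proof (rule integral_dominated_convergence[where w = "\<lambda>x. 9 * (cmod (f x))\<^sup>2"])
        show "integrable M (\<lambda>x. 9 * (cmod (f x))\<^sup>2)" using f by (simp add: sqint_def)
        show "AE x in M. (\<lambda>i. (cmod (f x - s i x))\<^sup>2) \<longlonglongrightarrow> 0"
        proof (rule AE_I2)
          fix x assume "x \<in> space M"
          have "(\<lambda>i. (cmod (f x - s i x))\<^sup>2) \<longlonglongrightarrow> (cmod (f x - f x))\<^sup>2"
            by (intro tendsto_intros lim) fact
          then show "(\<lambda>i. (cmod (f x - s i x))\<^sup>2) \<longlonglongrightarrow> 0" by simp
        qed
        show "AE x in M. norm ((cmod (f x - s i x))\<^sup>2) \<le> 9 * (cmod (f x))\<^sup>2" for i
        proof (rule AE_I2)
          fix x assume "x \<in> space M"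
          then have "cmod (f x - s i x) \<le> 3 * cmod (f x)"
            using norm_triangle_ineq4[of "f x" "s i x"] bound[of x i] by simp
          then have "(cmod (f x - s i x))\<^sup>2 \<le> (3 * cmod (f x))\<^sup>2" by (rule power_mono) simp
          then show "norm ((cmod (f x - s i x))\<^sup>2) \<le> 9 * (cmod (f x))\<^sup>2"
            by (simp add: power_mult_distrib)
        qed
      qed auto
      fix e :: real assume "e > 0"
      then have "\<forall>\<^sub>F i in sequentially. (\<integral>x. (cmod (f x - s i x))\<^sup>2 \<partial>M) < e"
        using \<open>(\<lambda>i. \<integral>x. (cmod (f x - s i x))\<^sup>2 \<partial>M) \<longlonglongrightarrow> (\<integral>x. 0 \<partial>M)\<close>
        by (intro order_tendstoD(2)) auto
      then obtain i where "(\<integral>x. (cmod (f x - s i x))\<^sup>2 \<partial>M) < e"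
        by (auto simp: eventually_sequentially)
      then show "\<exists>k\<in>L2_approximable M S. (\<integral>x. (cmod (f x - k x))\<^sup>2 \<partial>M) < e"
        using s_approx by blast
    qed
    then show "F \<in> L2_closed_span M S"
      using f(2) L2_approximable_closed_span by simp
  qed
qed

end

section \<open>Averages over fibres\<close>

text \<open>Polymorphic in the value field: complex averages give the transfer operator, real ones
  serve in monotone convergence and as dominating functions.\<close>

definition fibre_avg :: "('a \<Rightarrow> 'a) \<Rightarrow> ('a \<Rightarrow> 'b::real_normed_field) \<Rightarrow> 'a \<Rightarrow> 'b" where
  "fibre_avg r f x = (\<Sum>y\<in>r -` {x}. f y) / of_nat (card (r -` {x}))"

lemma transfer_op_eq: "transfer_op r m \<xi> = fibre_avg r (\<lambda>y. of_real ((cmod (m y))\<^sup>2) * \<xi> y)"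
  by (simp add: fun_eq_iff transfer_op_def fibre_avg_def)

text \<open>On the fibre over \<open>x\<close> the factor \<open>g (r y)\<close> has the constant
  value \<open>g x\<close> and leaves the sum.\<close>

lemma transfer_op_mult_comp: "transfer_op r m (\<lambda>y. g (r y) * \<xi> y) = (\<lambda>x. g x * transfer_op r m \<xi> x)"
proof
  fix x
  have "(\<Sum>y\<in>r -` {x}. of_real ((cmod (m y))\<^sup>2) * (g (r y) * \<xi> y))
    = g x * (\<Sum>y\<in>r -` {x}. of_real ((cmod (m y))\<^sup>2) * \<xi> y)"
    unfolding sum_distrib_left by (intro sum.cong) (auto simp: mult.left_commute)
  then show "transfer_op r m (\<lambda>y. g (r y) * \<xi> y) x = g x * transfer_op r m \<xi> x"
    by (simp add: transfer_op_def mult.left_commute)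
qed

text \<open>With \<open>g\<close> generalised, the inner \<open>n\<close> applications release
  \<open>g \<circ> r\<close>, and the outermost one turns it into \<open>g\<close>.\<close>

lemma transfer_op_funpow_mult_comp:
  "(transfer_op r m ^^ n) (\<lambda>y. g ((r ^^ n) y) * \<xi> y) = (\<lambda>x. g x * (transfer_op r m ^^ n) \<xi> x)"
proof (induction n arbitrary: g)
  case (Suc n)
  show ?case using Suc[of "g \<circ> r"] by (simp add: transfer_op_mult_comp)
qed simp

lemma fibre_avg_of_real:
  "fibre_avg r (\<lambda>y. of_real (u y) :: 'b::real_normed_field) x = of_real (fibre_avg r u x)"
  by (simp add: fibre_avg_def)

lemma norm_fibre_avg_le: "norm (fibre_avg r f x) \<le> fibre_avg r (\<lambda>y. norm (f y)) x"
  by (simp add: fibre_avg_def norm_divide divide_right_mono norm_sum)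

lemma fibre_avg_mono:
  fixes u v :: "'a \<Rightarrow> real"
  shows "(\<And>y. u y \<le> v y) \<Longrightarrow> fibre_avg r u x \<le> fibre_avg r v x"
  unfolding fibre_avg_def by (intro divide_right_mono sum_mono) auto

lemma fibre_avg_tendsto:
  "(\<And>y. (\<lambda>k. f k y) \<longlonglongrightarrow> g y) \<Longrightarrow> (\<lambda>k. fibre_avg r (f k) x) \<longlonglongrightarrow> fibre_avg r g x"
  unfolding fibre_avg_def divide_inverse by (intro tendsto_mult tendsto_sum tendsto_const)

text \<open>At each point the sequence is eventually constant. Cutting to 0 rather than capping
  makes sense in every normed space and is still monotone in \<open>k\<close> for non-negative
  functions.\<close>

lemma truncation_tendsto:
  "(\<lambda>k::nat. if norm (f y) \<le> real k then f y else 0) \<longlonglongrightarrow> (f y :: 'b::real_normed_vector)"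
proof (rule tendsto_eventually)
  have "\<forall>\<^sub>F k in sequentially. nat \<lceil>norm (f y)\<rceil> \<le> k" by (rule eventually_ge_at_top)
  then show "\<forall>\<^sub>F k in sequentially. (if norm (f y) \<le> real k then f y else 0) = f y"
    by eventually_elim (use nat_ceiling_le_eq in auto)
qed

section \<open>Strong invariance for integrable functions\<close>

locale strongly_invariant_map =
  fixes r :: "'a::metric_space \<Rightarrow> 'a" and \<mu> :: "'a measure"
  assumes r_borel: "r \<in> borel_measurable borel"
    and surj_r: "surj r"
    and finite_fibre: "\<And>x. finite (r -` {x})"
    and prob_space_mu: "prob_space \<mu>"
    and sets_mu: "sets \<mu> = sets borel"
    and strongly_inv: "strongly_invariant r \<mu>"
begin

lemma space_mu [simp]: "space \<mu> = UNIV"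
  using sets_eq_imp_space_eq[OF sets_mu] by simp

lemma borel_measurable_mu [simp]: "borel_measurable \<mu> = borel_measurable borel"
  by (rule measurable_cong_sets[OF sets_mu refl])

lemma finite_measure_mu: "finite_measure \<mu>"
  using prob_space_mu by (rule prob_space.finite_measure)

lemma card_fibre_pos: "card (r -` {x}) > 0"
  using finite_fibre surj_r by (metis card_gt_0_iff surjD vimage_singleton_eq empty_iff)

text \<open>The summand is constant on the fibre. Surjectivity of \<open>r\<close> enters here, as
  an empty fibre would have average 0.\<close>

lemma fibre_avg_comp: "fibre_avg r (f \<circ> r) x = f x"
proof -
  have "(\<Sum>y\<in>r -` {x}. (f \<circ> r) y) = of_nat (card (r -` {x})) * f x"
    by (simp add: sum.cong[of _ _ _ "\<lambda>_. f x"])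
  then show ?thesis using card_fibre_pos[of x] by (simp add: fibre_avg_def)
qed

lemma integral_fibre_avg_Linf: "f \<in> Linf \<mu> \<Longrightarrow> (\<integral>x. fibre_avg r f x \<partial>\<mu>) = (\<integral>x. f x \<partial>\<mu>)"
  using strongly_inv by (simp add: strongly_invariant_def fibre_avg_def)

text \<open>
  Strong invariance carries the measurability of fibre averages: were the average of \<open>f\<close> not
  integrable, neither would be that of \<open>f + 1\<close>, and the junk value 0 of both integrals
  would give $\int f = \int (f + 1) = 0$.
\<close>

lemma integrable_fibre_avg_Linf:
  assumes f: "f \<in> Linf \<mu>" shows "integrable \<mu> (fibre_avg r f)"
proof (rule ccontr)
  assume not: "\<not> integrable \<mu> (fibre_avg r f)"
  interpret prob_space \<mu> by (rule prob_space_mu)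
  have eq: "fibre_avg r (\<lambda>y. f y + 1) x = fibre_avg r f x + 1" for x
    using card_fibre_pos[of x] by (simp add: fibre_avg_def sum.distrib add_divide_distrib)
  have "\<not> integrable \<mu> (fibre_avg r (\<lambda>y. f y + 1))"
  proof
    assume "integrable \<mu> (fibre_avg r (\<lambda>y. f y + 1))"
    then have "integrable \<mu> (\<lambda>x. fibre_avg r (\<lambda>y. f y + 1) x - 1)" by simp
    then show False using not by (simp add: eq)
  qed
  then have "(\<integral>x. f x + 1 \<partial>\<mu>) = 0"
    using integral_fibre_avg_Linf[OF Linf_add[OF f Linf_const[of 1]]]
    by (simp add: not_integrable_integral_eq)
  moreover have "(\<integral>x. f x \<partial>\<mu>) = 0"
    using integral_fibre_avg_Linf[OF f] not by (simp add: not_integrable_integral_eq)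
  ultimately show False
    using integrable_Linf[OF finite_measure_mu f] prob_space by simp
qed

lemma truncation_Linf:
  assumes "f \<in> borel_measurable borel"
  shows "(\<lambda>y. if norm (f y) \<le> real k then f y else 0) \<in> Linf \<mu>"
  using assms by (auto simp: Linf_def intro!: exI[of _ "real k"])

text \<open>Averaging over finite fibres commutes with pointwise limits, and the averages of the
  truncations are integrable, hence measurable.\<close>

lemma borel_measurable_fibre_avg:
  fixes f :: "'a \<Rightarrow> complex"
  assumes f: "f \<in> borel_measurable borel"
  shows "fibre_avg r f \<in> borel_measurable borel"
proof (rule borel_measurable_LIMSEQ_metric)
  show "fibre_avg r (\<lambda>y. if norm (f y) \<le> real k then f y else 0) \<in> borel_measurable borel" for k
    using borel_measurable_integrable[OF integrable_fibre_avg_Linf[OF truncation_Linf[OF f]]] by simp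
qed (rule fibre_avg_tendsto[OF truncation_tendsto])

text \<open>Supplies the dominating function for the general case. Invariance identifies the
  integrals of the increasing averages with those of the truncations, and these have the finite
  limit that monotone convergence asks for.\<close>

lemma integrable_fibre_avg_nonneg:
  fixes u :: "'a \<Rightarrow> real"
  assumes u: "integrable \<mu> u" "\<And>y. 0 \<le> u y"
  shows "integrable \<mu> (fibre_avg r u)"
proof -
  define t where "t k y = (if norm (u y) \<le> real k then u y else 0)" for k y
  have [measurable]: "u \<in> borel_measurable borel"
    using borel_measurable_integrable[OF u(1)] by simp
  have Linf: "(\<lambda>y. complex_of_real (t k y)) \<in> Linf \<mu>" for k
    by (auto simp: Linf_def t_def intro!: exI[of _ "real k"])
  have int: "integrable \<mu> (fibre_avg r (t k))" for k
    using integrable_Re[OF integrable_fibre_avg_Linf[OF Linf[of k]]] by (simp add: fibre_avg_of_real)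
  have int_t: "integrable \<mu> (t k)" for k
    using integrable_Re[OF integrable_Linf[OF finite_measure_mu Linf[of k]]] by simp
  have eq: "(\<integral>x. fibre_avg r (t k) x \<partial>\<mu>) = (\<integral>x. t k x \<partial>\<mu>)" for k
    using integral_fibre_avg_Linf[OF Linf[of k]] by (simp add: fibre_avg_of_real)
  have lim: "(\<lambda>k. t k y) \<longlonglongrightarrow> u y" for y
    unfolding t_def by (rule truncation_tendsto)
  show ?thesis
  proof (rule integrable_monotone_convergence[OF int])
    show "AE x in \<mu>. mono (\<lambda>k. fibre_avg r (t k) x)"
      using u(2) by (auto simp: mono_def t_def intro!: fibre_avg_mono)
    show "AE x in \<mu>. (\<lambda>k. fibre_avg r (t k) x) \<longlonglongrightarrow> fibre_avg r u x"
      by (intro AE_I2 fibre_avg_tendsto lim)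
    show "(\<lambda>k. \<integral>x. fibre_avg r (t k) x \<partial>\<mu>) \<longlonglongrightarrow> (\<integral>x. u x \<partial>\<mu>)"
      unfolding eq
      by (rule integral_dominated_convergence[where w = u])
        (use u lim borel_measurable_integrable[OF int_t] borel_measurable_integrable[OF u(1)] in
          \<open>auto simp: t_def\<close>)
    show "fibre_avg r u \<in> borel_measurable \<mu>"
      using borel_measurable_LIMSEQ_metric[OF borel_measurable_integrable[OF int] fibre_avg_tendsto[OF lim]]
      by simp
  qed
qed

text \<open>The average of \<open>norm (f y)\<close> dominates the averages of all truncations, so
  both sides of the identity for bounded functions pass to the limit.\<close>

lemma
  fixes f :: "'a \<Rightarrow> complex"
  assumes f: "integrable \<mu> f"
  shows integrable_fibre_avg: "integrable \<mu> (fibre_avg r f)"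
    and integral_fibre_avg: "(\<integral>x. fibre_avg r f x \<partial>\<mu>) = (\<integral>x. f x \<partial>\<mu>)"
proof -
  define t where "t k y = (if norm (f y) \<le> real k then f y else 0)" for k y
  have fm [measurable]: "f \<in> borel_measurable borel"
    using borel_measurable_integrable[OF f] by simp
  have t: "t k \<in> Linf \<mu>" for k unfolding t_def[abs_def] by (rule truncation_Linf[OF fm])
  have lim: "(\<lambda>k. t k y) \<longlonglongrightarrow> f y" for y
    unfolding t_def by (rule truncation_tendsto)
  have tm: "t k \<in> borel_measurable borel" for k using Linf_measurable[OF t] by simp
  have dom: "integrable \<mu> (fibre_avg r (\<lambda>y. norm (f y)))"
    using f by (intro integrable_fibre_avg_nonneg) auto
  have bound: "AE x in \<mu>. norm (fibre_avg r (t k) x) \<le> fibre_avg r (\<lambda>y. norm (f y)) x" for k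
    by (intro AE_I2 order_trans[OF norm_fibre_avg_le] fibre_avg_mono) (simp add: t_def)
  have m: "fibre_avg r f \<in> borel_measurable \<mu>" "fibre_avg r (t k) \<in> borel_measurable \<mu>" for k
    using borel_measurable_fibre_avg fm tm by auto
  have avlim: "AE x in \<mu>. (\<lambda>k. fibre_avg r (t k) x) \<longlonglongrightarrow> fibre_avg r f x"
    by (intro AE_I2 fibre_avg_tendsto lim)
  show "integrable \<mu> (fibre_avg r f)"
    by (rule integrable_dominated_convergence[OF m dom avlim bound])
  have "(\<lambda>k. \<integral>x. fibre_avg r (t k) x \<partial>\<mu>) \<longlonglongrightarrow> (\<integral>x. fibre_avg r f x \<partial>\<mu>)"
    by (rule integral_dominated_convergence[OF m dom avlim bound])
  moreover have "(\<lambda>k. \<integral>x. t k x \<partial>\<mu>) \<longlonglongrightarrow> (\<integral>x. f x \<partial>\<mu>)"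
    by (rule integral_dominated_convergence[where w = "\<lambda>x. norm (f x)"])
      (use f lim tm in \<open>auto simp: t_def\<close>)
  ultimately show "(\<integral>x. fibre_avg r f x \<partial>\<mu>) = (\<integral>x. f x \<partial>\<mu>)"
    using LIMSEQ_unique by (simp add: integral_fibre_avg_Linf[OF t])
qed

lemma AE_comp_r:
  assumes "AE x in \<mu>. P x" shows "AE x in \<mu>. P (r x)"
proof -
  interpret prob_space \<mu> by (rule prob_space_mu)
  obtain N where N: "N \<in> null_sets \<mu>" "{x. \<not> P x} \<subseteq> N"
    using assms by (auto elim!: AE_E simp: null_sets_def)
  have Ns: "N \<in> sets borel" using N sets_mu by auto
  have rN: "r -` N \<in> sets borel"
    using measurable_sets[OF r_borel Ns] by simp
  have ind: "(indicator N \<circ> r :: 'a \<Rightarrow> complex) = indicator (r -` N)"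
    by (auto simp: fun_eq_iff indicator_def)
  have "(\<integral>x. (indicator N \<circ> r :: 'a \<Rightarrow> complex) x \<partial>\<mu>) = (\<integral>x. fibre_avg r (indicator N \<circ> r) x \<partial>\<mu>)"
    by (rule integral_fibre_avg_Linf[symmetric])
      (use Linf_indicator[of "r -` N" \<mu>] rN sets_mu in \<open>simp only: ind\<close>)
  also have "\<dots> = complex_of_real (measure \<mu> N)"
    using integral_indicator_complex[of N \<mu>] N by (simp add: fibre_avg_comp null_setsD2)
  also note ind
  finally have "measure \<mu> (r -` N) = 0"
    using N rN sets_mu integral_indicator_complex[of "r -` N" \<mu>] by (simp add: measure_eq_0_null_sets)
  then have "r -` N \<in> null_sets \<mu>"
    using rN sets_mu by (simp add: null_sets_def emeasure_eq_measure)
  then show ?thesis by (rule AE_I') (use N in auto)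
qed

lemma Linf_comp_r: "f \<in> Linf \<mu> \<Longrightarrow> f \<circ> r \<in> Linf \<mu>"
  using Linf_comp_nonsingular[of f \<mu> r \<mu>] AE_comp_r r_borel
  by (simp add: measurable_cong_sets[OF sets_mu sets_mu])

lemma Linf_comp_r_funpow: "f \<in> Linf \<mu> \<Longrightarrow> (\<lambda>x. f ((r ^^ n) x)) \<in> Linf \<mu>"
proof (induction n arbitrary: f)
  case (Suc n)
  show ?case using Suc.IH[OF Linf_comp_r[OF Suc.prems]] by simp
qed simp

end

section \<open>The covariant system on the solenoid\<close>

lemma theta_Suc_r_hat [simp]: "\<theta> (Suc n) (r_hat r x) = \<theta> n x"
  by (simp add: \<theta>_def r_hat_def)

lemma theta_0_r_hat [simp]: "\<theta> 0 (r_hat r x) = r (\<theta> 0 x)"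
  by (simp add: \<theta>_def r_hat_def)

lemma r_hat_solenoid [simp]: "x \<in> solenoid r \<Longrightarrow> r_hat r x \<in> solenoid r"
  by (auto simp: solenoid_def r_hat_def split: nat.split)

text \<open>The shift is the inverse of \<open>r_hat r\<close> on the solenoid; this half of the
  statement holds for every sequence.\<close>

lemma shift_r_hat [simp]: "r_hat r x \<circ> Suc = x"
  by (auto simp: r_hat_def)

lemma theta_shift [simp]: "\<theta> n (x \<circ> Suc) = \<theta> (Suc n) x"
  by (simp add: \<theta>_def)

lemma shift_solenoid [simp]: "x \<in> solenoid r \<Longrightarrow> x \<circ> Suc \<in> solenoid r"
  by (simp add: solenoid_def)

lemma theta_Suc: "x \<in> solenoid r \<Longrightarrow> r (\<theta> (Suc n) x) = \<theta> n x"
  by (simp add: solenoid_def \<theta>_def)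

lemma theta_add: "x \<in> solenoid r \<Longrightarrow> (r ^^ k) (\<theta> (k + n) x) = \<theta> n x"
  by (induction k) (simp_all add: funpow_swap1 theta_Suc del: funpow.simps add: funpow_Suc_right)

locale covariant_filter = strongly_invariant_map r \<mu>
  for r :: "'a::metric_space \<Rightarrow> 'a" and \<mu> :: "'a measure" +
  fixes m\<^sub>0 :: "'a \<Rightarrow> complex" and h :: "'a \<Rightarrow> real" and M :: "(nat \<Rightarrow> 'a) measure"
  assumes m0_Linf: "m\<^sub>0 \<in> Linf \<mu>"
    and m0_nonsingular: "nonsingular \<mu> m\<^sub>0"
    and integrable_h: "integrable \<mu> h"
    and hat_measure: "is_hat_measure r \<mu> m\<^sub>0 h M"
begin

section \<open>Measurable structure of the solenoid\<close>

definition cyl :: "(nat \<Rightarrow> 'a) set set" where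
  "cyl = {\<theta> n -` A \<inter> solenoid r | n A. A \<in> sets borel}"

lemma finite_measure_M: "finite_measure M"
  and space_M [simp]: "space M = solenoid r"
  and sets_M: "sets M = sigma_sets (solenoid r) cyl"
  using hat_measure by (simp_all add: is_hat_measure_def solenoid_sets_def cyl_def)

sublocale finite_measure M by (rule finite_measure_M)

lemma cyl_subset: "cyl \<subseteq> Pow (solenoid r)"
  by (auto simp: cyl_def)

lemma cyl_sets: "A \<in> cyl \<Longrightarrow> A \<in> sets M"
  by (simp add: sets_M sigma_sets.Basic)

lemma measurable_into_M:
  assumes "f \<in> space N \<rightarrow> solenoid r" "\<And>n. (\<lambda>x. \<theta> n (f x)) \<in> borel_measurable N"
  shows "f \<in> measurable N M"
proof (rule measurable_sigma_sets[OF sets_M cyl_subset assms(1)])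
  fix Y assume "Y \<in> cyl"
  then obtain n A where Y: "Y = \<theta> n -` A \<inter> solenoid r" "A \<in> sets borel" by (auto simp: cyl_def)
  have "f -` Y \<inter> space N = (\<lambda>x. \<theta> n (f x)) -` A \<inter> space N" using assms(1) Y(1) by auto
  then show "f -` Y \<inter> space N \<in> sets N" using measurable_sets[OF assms(2) Y(2)] by simp
qed

lemma theta_measurable [measurable]: "\<theta> n \<in> borel_measurable M"
proof (rule borel_measurableI, rule cyl_sets)
  fix S :: "'a set" assume "open S"
  then have "S \<in> sets borel" by simp
  then show "\<theta> n -` S \<inter> space M \<in> cyl" unfolding cyl_def space_M by blast
qed

lemma r_measurable [measurable]: "r \<in> borel_measurable borel"
  by (rule r_borel)

lemma r_funpow_measurable [measurable]: "r ^^ n \<in> borel_measurable borel"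
  by (rule measurable_compose_n) (rule r_borel)

lemma r_hat_measurable [measurable]: "r_hat r \<in> measurable M M"
proof (rule measurable_into_M)
  show "(\<lambda>x. \<theta> n (r_hat r x)) \<in> borel_measurable M" for n by (cases n) simp_all
qed simp

lemma shift_measurable [measurable]: "(\<lambda>x. x \<circ> Suc) \<in> measurable M M"
  by (rule measurable_into_M) simp_all

text \<open>A condition on one coordinate is also a condition on any later coordinate, pulled back
  along a power of \<open>r\<close>. Two conditions can therefore be imposed on the later of the two
  coordinates.\<close>

lemma cyl_Int_stable: "Int_stable cyl"
proof (rule Int_stableI)
  have *: "\<theta> n -` A \<inter> solenoid r \<inter> (\<theta> (k + n) -` B \<inter> solenoid r) \<in> cyl"
    if [measurable]: "A \<in> sets borel" "B \<in> sets borel" for n k A B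
  proof -
    have "\<theta> n -` A \<inter> solenoid r \<inter> (\<theta> (k + n) -` B \<inter> solenoid r)
      = \<theta> (k + n) -` ((r ^^ k) -` A \<inter> B) \<inter> solenoid r"
      by (auto simp: theta_add)
    moreover have "(r ^^ k) -` A \<inter> B \<in> sets borel"
      using measurable_sets[OF r_funpow_measurable that(1)] that(2) by auto
    ultimately show ?thesis unfolding cyl_def by blast
  qed
  fix X Y assume "X \<in> cyl" "Y \<in> cyl"
  then obtain n A k B where XY: "X = \<theta> n -` A \<inter> solenoid r" "A \<in> sets borel"
    "Y = \<theta> k -` B \<inter> solenoid r" "B \<in> sets borel" unfolding cyl_def by blast
  show "X \<inter> Y \<in> cyl"
  proof (cases "n \<le> k")
    case True then show ?thesis using *[OF XY(2,4), of n "k - n"] XY by simp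
  next
    case False then show ?thesis using *[OF XY(4,2), of k "n - k"] XY by (simp add: Int_commute)
  qed
qed

lemma solenoid_cyl: "solenoid r \<in> cyl"
  unfolding cyl_def by (rule CollectI, rule exI[of _ 0], rule exI[of _ UNIV]) auto

section \<open>Integral identities for the filter\<close>

lemma m0_borel [measurable]: "m\<^sub>0 \<in> borel_measurable borel"
  using Linf_measurable[OF m0_Linf] by simp

lemma m0_square_Linf: "(\<lambda>x. of_real ((cmod (m\<^sub>0 x))\<^sup>2)) \<in> Linf \<mu>"
  using Linf_mult[OF m0_Linf Linf_cnj[OF m0_Linf]] unfolding complex_norm_square .

lemma integrable_transfer_op:
  "integrable \<mu> \<xi> \<Longrightarrow> integrable \<mu> (transfer_op r m\<^sub>0 \<xi>)"
  unfolding transfer_op_eq by (intro integrable_fibre_avg Linf_mult_integrable m0_square_Linf)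

lemma integral_transfer_op:
  "integrable \<mu> \<xi> \<Longrightarrow>
    (\<integral>x. transfer_op r m\<^sub>0 \<xi> x \<partial>\<mu>) = (\<integral>x. of_real ((cmod (m\<^sub>0 x))\<^sup>2) * \<xi> x \<partial>\<mu>)"
  unfolding transfer_op_eq by (intro integral_fibre_avg Linf_mult_integrable m0_square_Linf)

lemma integrable_transfer_op_funpow:
  "integrable \<mu> \<xi> \<Longrightarrow> integrable \<mu> ((transfer_op r m\<^sub>0 ^^ n) \<xi>)"
  by (induction n) (simp_all add: integrable_transfer_op)

lemma integral_theta:
  assumes "f \<in> Linf \<mu>"
  shows "(\<integral>x. f (\<theta> n x) \<partial>M) = (\<integral>x. (transfer_op r m\<^sub>0 ^^ n) (\<lambda>y. f y * of_real (h y)) x \<partial>\<mu>)"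
  using hat_measure assms by (simp add: is_hat_measure_def)

lemma integral_theta_Suc:
  assumes f: "f \<in> Linf \<mu>"
  shows "(\<integral>x. of_real ((cmod (m\<^sub>0 (\<theta> 0 x)))\<^sup>2) * f (\<theta> n x) \<partial>M) = (\<integral>x. f (\<theta> (Suc n) x) \<partial>M)"
proof -
  define w where "w x = complex_of_real ((cmod (m\<^sub>0 x))\<^sup>2)" for x
  have w: "w \<in> Linf \<mu>" unfolding w_def by (rule m0_square_Linf)
  have int: "integrable \<mu> (\<lambda>y. f y * of_real (h y))"
    using Linf_mult_integrable[OF f] integrable_h by simp
  have "(\<integral>x. w (\<theta> 0 x) * f (\<theta> n x) \<partial>M) = (\<integral>x. (w ((r ^^ n) (\<theta> n x)) * f (\<theta> n x)) \<partial>M)"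
    by (rule Bochner_Integration.integral_cong) (use theta_add[of _ r n 0] in auto)
  \<comment> \<open>Both factors now depend on coordinate \<open>n\<close> alone, so the defining
    property of the measure applies to their product.\<close>
  also have "\<dots> = (\<integral>x. (transfer_op r m\<^sub>0 ^^ n) (\<lambda>y. w ((r ^^ n) y) * (f y * of_real (h y))) x \<partial>\<mu>)"
    using integral_theta[OF Linf_mult[OF Linf_comp_r_funpow[OF w] f], of n n] by (simp add: mult.assoc)
  also have "\<dots> = (\<integral>x. w x * (transfer_op r m\<^sub>0 ^^ n) (\<lambda>y. f y * of_real (h y)) x \<partial>\<mu>)"
    by (subst transfer_op_funpow_mult_comp) (rule refl)
  \<comment> \<open>Read from right to left, \<open>integral_transfer_op\<close> absorbs the weight
    into one more application of the transfer operator.\<close>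
  also have "\<dots> = (\<integral>x. (transfer_op r m\<^sub>0 ^^ Suc n) (\<lambda>y. f y * of_real (h y)) x \<partial>\<mu>)"
    using integral_transfer_op[OF integrable_transfer_op_funpow[OF int], of n] by (simp add: w_def)
  also have "\<dots> = (\<integral>x. f (\<theta> (Suc n) x) \<partial>M)" by (rule integral_theta[OF f, symmetric])
  finally show ?thesis by (simp add: w_def)
qed

text \<open>By the defining property for n = 0 the law of \<open>\<theta> 0\<close> has density
  \<open>h\<close> with respect to \<open>\<mu>\<close>, so it vanishes on the null sets of
  \<open>\<mu>\<close>.\<close>

lemma AE_theta_0:
  assumes "AE x in \<mu>. P x" shows "AE x in M. P (\<theta> 0 x)"
proof -
  obtain N where N: "N \<in> null_sets \<mu>" "{x. \<not> P x} \<subseteq> N"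
    using assms by (auto elim!: AE_E simp: null_sets_def)
  have Ns: "N \<in> sets \<mu>" "N \<in> sets borel" using N sets_mu by auto
  have X: "\<theta> 0 -` N \<inter> solenoid r \<in> sets M" using Ns by (intro cyl_sets) (auto simp: cyl_def)
  have "complex_of_real (measure M (\<theta> 0 -` N \<inter> solenoid r)) = (\<integral>x. indicator N (\<theta> 0 x) \<partial>M)"
    unfolding integral_indicator_complex[OF X, symmetric]
    by (rule Bochner_Integration.integral_cong) (auto simp: indicator_def)
  also have "\<dots> = (\<integral>x. indicator N x * of_real (h x) \<partial>\<mu>)"
    using integral_theta[OF Linf_indicator[OF Ns(1)], of 0] by simp
  also have "\<dots> = 0"
    using AE_not_in[OF N(1)] by (intro integral_eq_zero_AE) (auto elim!: eventually_mono)
  finally have "\<theta> 0 -` N \<inter> solenoid r \<in> null_sets M"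
    using X by (simp add: null_sets_def emeasure_eq_measure)
  then show ?thesis by (rule AE_I') (use N in auto)
qed

lemma AE_m0_nonzero: "AE x in M. m\<^sub>0 (\<theta> 0 x) \<noteq> 0"
proof (rule AE_theta_0)
  have s: "{x. m\<^sub>0 x = 0} \<in> sets \<mu>"
    using measurable_sets[OF m0_borel, of "{0}"] by (simp add: sets_mu vimage_def)
  then have "emeasure \<mu> {x. m\<^sub>0 x = 0} = 0"
    using m0_nonsingular by (auto simp: nonsingular_def zero_less_iff_neq_zero)
  then show "AE x in \<mu>. m\<^sub>0 x \<noteq> 0"
    using s by (intro AE_I[of _ _ "{x. m\<^sub>0 x = 0}"]) auto
qed

section \<open>Change of variables along the solenoid map\<close>

definition weight :: "(nat \<Rightarrow> 'a) \<Rightarrow> real" where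
  "weight x = (cmod (m\<^sub>0 (\<theta> 0 x)))\<^sup>2"

lemma weight_measurable [measurable]: "weight \<in> borel_measurable M"
  unfolding weight_def[abs_def] by measurable

lemma weight_nonneg [simp]: "0 \<le> weight x"
  by (simp add: weight_def)

lemma weight_Linf: "(\<lambda>x. complex_of_real (weight x)) \<in> Linf M"
  using Linf_comp_nonsingular[OF m0_square_Linf, of "\<theta> 0" M] AE_theta_0
  by (simp add: comp_def weight_def measurable_cong_sets[OF refl sets_mu])

text \<open>
  Every cylinder on coordinate \<open>n\<close> is also one on coordinate \<open>Suc n\<close>, so \<open>integral_theta_Suc\<close>
  covers the whole generator.
\<close>

lemma distr_density_weight: "distr (density M weight) M (r_hat r) = M"
proof -
  have eq_cyl: "emeasure (distr (density M weight) M (r_hat r)) X = emeasure M X" if X: "X \<in> cyl" for X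
  proof -
    from X obtain n A where XA: "X = \<theta> n -` A \<inter> solenoid r" and A: "A \<in> sets borel" by (auto simp: cyl_def)
    define B where "B = r -` A"
    have B: "B \<in> sets \<mu>" using measurable_sets[OF r_borel A] by (simp add: B_def sets_mu)
    have XB: "X = \<theta> (Suc n) -` B \<inter> solenoid r" using XA by (auto simp: B_def theta_Suc)
    have pre: "r_hat r -` X \<inter> solenoid r = \<theta> n -` B \<inter> solenoid r" by (auto simp: XB)
    have Y: "\<theta> n -` B \<inter> solenoid r \<in> sets M" using B sets_mu by (intro cyl_sets) (auto simp: cyl_def)
    have "complex_of_real (\<integral>x. weight x * indicator (\<theta> n -` B \<inter> solenoid r) x \<partial>M)
      = (\<integral>x. of_real ((cmod (m\<^sub>0 (\<theta> 0 x)))\<^sup>2) * indicator B (\<theta> n x) \<partial>M)"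
      unfolding integral_complex_of_real[symmetric]
      by (rule Bochner_Integration.integral_cong) (auto simp: weight_def indicator_def)
    also have "\<dots> = (\<integral>x. indicator B (\<theta> (Suc n) x) \<partial>M)"
      by (rule integral_theta_Suc[OF Linf_indicator[OF B]])
    also have "\<dots> = (\<integral>x. indicator X x \<partial>M)"
      by (rule Bochner_Integration.integral_cong) (auto simp: XB indicator_def)
    also have "\<dots> = complex_of_real (measure M X)"
      by (rule integral_indicator_complex[OF cyl_sets[OF X]])
    finally have eq: "(\<integral>x. weight x * indicator (\<theta> n -` B \<inter> solenoid r) x \<partial>M) = measure M X"
      unfolding of_real_eq_iff .
    \<comment> \<open>The Bochner identity \<open>eq\<close> determines the non-negative integral
      below only together with integrability.\<close>
    have int: "integrable M (\<lambda>x. weight x * indicator (\<theta> n -` B \<inter> solenoid r) x)"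
      using integrable_real_mult_indicator[OF Y] integrable_Re[OF integrable_Linf[OF finite_measure_M  weight_Linf]]
      by simp
    have "emeasure (distr (density M weight) M (r_hat r)) X
      = (\<integral>\<^sup>+x. ennreal (weight x) * indicator (\<theta> n -` B \<inter> solenoid r) x \<partial>M)"
      using cyl_sets[OF X] Y by (simp add: emeasure_distr emeasure_density pre)
    also have "\<dots> = (\<integral>\<^sup>+x. ennreal (weight x * indicator (\<theta> n -` B \<inter> solenoid r) x) \<partial>M)"
      by (intro nn_integral_cong) (auto simp: indicator_def)
    also have "\<dots> = emeasure M X"
      using int eq by (simp add: nn_integral_eq_integral emeasure_eq_measure)
    finally show ?thesis .
  qed
  \<comment> \<open>The measure is finite and the whole solenoid is a cylinder, so a constant
    sequence exhausts the space.\<close>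
  show ?thesis
    by (rule measure_eqI_generator_eq[OF cyl_Int_stable cyl_subset, where A = "\<lambda>_. solenoid r"])
      (auto simp: sets_M solenoid_cyl eq_cyl emeasure_eq_measure)
qed

text \<open>Banach-valued, to cover squared moduli as well as complex inner products. The
  equivalence in the first claim matters in both directions: \<open>U\<close> preserves square
  integrability, and its surjectivity needs the converse.\<close>

lemma integral_weight_r_hat:
  fixes f :: "(nat \<Rightarrow> 'a) \<Rightarrow> 'b::{banach, second_countable_topology}"
  assumes f [measurable]: "f \<in> borel_measurable M"
  shows "integrable M (\<lambda>x. weight x *\<^sub>R f (r_hat r x)) \<longleftrightarrow> integrable M f"
    and "(\<integral>x. weight x *\<^sub>R f (r_hat r x) \<partial>M) = (\<integral>x. f x \<partial>M)"
proof -
  have [measurable]: "r_hat r \<in> measurable (density M weight) M"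
    using r_hat_measurable by simp
  have "integrable M (\<lambda>x. weight x *\<^sub>R f (r_hat r x)) \<longleftrightarrow> integrable (density M weight) (\<lambda>x. f (r_hat r x))"
    by (subst integrable_density) auto
  also have "\<dots> \<longleftrightarrow> integrable (distr (density M weight) M (r_hat r)) f"
    by (subst integrable_distr_eq) auto
  finally show "integrable M (\<lambda>x. weight x *\<^sub>R f (r_hat r x)) \<longleftrightarrow> integrable M f"
    unfolding distr_density_weight .
  have "(\<integral>x. weight x *\<^sub>R f (r_hat r x) \<partial>M) = (\<integral>x. f (r_hat r x) \<partial>density M weight)"
    by (subst integral_density) auto
  also have "\<dots> = (\<integral>x. f x \<partial>distr (density M weight) M (r_hat r))"
    by (subst integral_distr) auto
  finally show "(\<integral>x. weight x *\<^sub>R f (r_hat r x) \<partial>M) = (\<integral>x. f x \<partial>M)"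
    unfolding distr_density_weight .
qed

text \<open>The change of variables yields the property only where the weight is positive; by
  non-singularity that is almost everywhere. This makes \<open>U\<close> well defined on
  classes.\<close>

lemma AE_r_hat:
  assumes "AE x in M. P x" shows "AE x in M. P (r_hat r x)"
proof -
  have "AE x in distr (density M weight) M (r_hat r). P x"
    using assms unfolding distr_density_weight .
  then have "AE x in density M weight. P (r_hat r x)"
    by (rule AE_distrD[rotated]) (use r_hat_measurable in simp)
  then have "AE x in M. 0 < weight x \<longrightarrow> P (r_hat r x)"
    by (subst (asm) AE_density) auto
  then show ?thesis
    using AE_m0_nonzero by eventually_elim (simp add: weight_def)
qed

section \<open>Unitarity of the operator\<close>

abbreviation "U \<equiv> cov_U r m\<^sub>0 M"

abbreviation "V \<equiv> inv_into (L2 M) U"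

lemma U_class:
  assumes "f \<in> borel_measurable M"
  shows "U (ae_class M f) = ae_class M (\<lambda>x. m\<^sub>0 (\<theta> 0 x) * f (r_hat r x))"
  unfolding cov_U_def by (rule ae_lift_class[OF assms], drule AE_r_hat) (auto elim: eventually_mono)

lemma sqint_U_iff:
  assumes [measurable]: "f \<in> borel_measurable M"
  shows "(\<lambda>x. m\<^sub>0 (\<theta> 0 x) * f (r_hat r x)) \<in> sqint M \<longleftrightarrow> f \<in> sqint M"
  using integral_weight_r_hat(1)[of "\<lambda>x. (cmod (f x))\<^sup>2"]
  by (simp add: sqint_def weight_def norm_mult power_mult_distrib)

lemma U_inner:
  assumes [measurable]: "f \<in> borel_measurable M" "g \<in> borel_measurable M"
  shows "L2_inner M (U (ae_class M f)) (U (ae_class M g)) = L2_inner M (ae_class M f) (ae_class M g)"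
proof -
  have "L2_inner M (U (ae_class M f)) (U (ae_class M g))
    = (\<integral>x. cnj (m\<^sub>0 (\<theta> 0 x) * f (r_hat r x)) * (m\<^sub>0 (\<theta> 0 x) * g (r_hat r x)) \<partial>M)"
    by (simp add: U_class assms L2_inner_class)
  also have "\<dots> = (\<integral>x. weight x *\<^sub>R (cnj (f (r_hat r x)) * g (r_hat r x)) \<partial>M)"
    by (rule Bochner_Integration.integral_cong)
      (simp_all add: weight_def scaleR_conv_of_real complex_norm_square mult_ac del: of_real_power)
  also have "\<dots> = (\<integral>x. cnj (f x) * g x \<partial>M)"
    by (rule integral_weight_r_hat(2)) (intro borel_measurable_times borel_measurable_cnj assms)
  finally show ?thesis by (simp add: L2_inner_class assms)
qed

lemma U_in_L2:
  assumes "F \<in> L2 M" shows "U F \<in> L2 M"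
proof -
  obtain f where f: "f \<in> sqint M" "F = ae_class M f" using assms by (rule L2_E)
  then show ?thesis
    by (auto simp: U_class sqint_measurable sqint_U_iff intro!: ae_class_in_L2)
qed

text \<open>The change of variables is applied directly to the squared modulus of the difference of
  two representatives, so that linearity of \<open>U\<close> is not presupposed.\<close>

lemma U_inj: "inj_on U (L2 M)"
proof (rule inj_onI)
  fix F G assume "F \<in> L2 M" "G \<in> L2 M" and eq: "U F = U G"
  then obtain f g where fg: "f \<in> sqint M" "F = ae_class M f" "g \<in> sqint M" "G = ae_class M g"
    by (auto elim!: L2_E)
  have [measurable]: "f \<in> borel_measurable M" "g \<in> borel_measurable M"
    using fg by (auto simp: sqint_measurable)
  have "AE x in M. m\<^sub>0 (\<theta> 0 x) * f (r_hat r x) = m\<^sub>0 (\<theta> 0 x) * g (r_hat r x)"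
    using eq fg by (simp add: U_class ae_class_eq_iff)
  then have zero: "AE x in M. weight x *\<^sub>R (cmod (f (r_hat r x) - g (r_hat r x)))\<^sup>2 = 0"
    by eventually_elim (auto simp: weight_def)
  have sq: "integrable M (\<lambda>x. (cmod (f x - g x))\<^sup>2)"
    using sqint_diff[OF fg(1,3)] by (simp add: sqint_def)
  have "(\<integral>x. (cmod (f x - g x))\<^sup>2 \<partial>M) = 0"
    using integral_weight_r_hat(2)[of "\<lambda>x. (cmod (f x - g x))\<^sup>2"] integral_eq_zero_AE[OF zero] by simp
  then have "AE x in M. (cmod (f x - g x))\<^sup>2 = 0"
    using integral_nonneg_eq_0_iff_AE[OF sq] by simp
  then show "F = G" using fg by (auto intro!: ae_class_cong elim: eventually_mono)
qed

lemma U_surj: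
  assumes "F \<in> L2 M" shows "\<exists>G\<in>L2 M. U G = F"
proof -
  obtain f where f: "f \<in> sqint M" "F = ae_class M f" using assms by (rule L2_E)
  have [measurable]: "f \<in> borel_measurable M" using f by (simp add: sqint_measurable)
  \<comment> \<open>The candidate for the inverse image: divide by
    \<open>m\<^sub>0 \<circ> \<theta> 0\<close>, then compose with the shift. In
    \<open>k (r_hat r x)\<close> the divisor is \<open>m\<^sub>0 (\<theta> 0 x)\<close>, so division
    by zero, with value 0, affects only a null set of \<open>x\<close>.\<close>
  define k where "k x = f (x \<circ> Suc) / m\<^sub>0 (\<theta> 0 (x \<circ> Suc))" for x
  have k [measurable]: "k \<in> borel_measurable M"
    unfolding k_def[abs_def] by (intro borel_measurable_divide) measurable
  have eq: "AE x in M. f x = m\<^sub>0 (\<theta> 0 x) * k (r_hat r x)"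
    using AE_m0_nonzero by eventually_elim (simp add: k_def del: theta_shift)
  \<comment> \<open>The reciprocal of \<open>m\<^sub>0\<close> may be unbounded, so square
    integrability of \<open>k\<close> is not estimated but read off from that of its image.\<close>
  have "(\<lambda>x. m\<^sub>0 (\<theta> 0 x) * k (r_hat r x)) \<in> sqint M"
    by (rule sqint_cong_AE[OF f(1) _ eq]) measurable
  then have "k \<in> sqint M" by (simp add: sqint_U_iff k)
  moreover have "U (ae_class M k) = F"
    using f(2) ae_class_cong[OF eq] by (simp add: U_class k)
  ultimately show ?thesis using ae_class_in_L2 by blast
qed

lemma U_bij: "bij_betw U (L2 M) (L2 M)"
  unfolding bij_betw_def using U_inj U_in_L2 U_surj by blast

lemma U_V: "F \<in> L2 M \<Longrightarrow> U (V F) = F" and V_in_L2: "F \<in> L2 M \<Longrightarrow> V F \<in> L2 M"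
  and V_U: "F \<in> L2 M \<Longrightarrow> V (U F) = F"
  using U_bij by (simp_all add: bij_betw_inv_into_right bij_betw_inv_into_left bij_betwE[OF bij_betw_inv_into])

lemma U_unitary: "L2_unitary M U"
proof -
  note [simp] = U_class sqint_measurable L2_add_class L2_scale_class sqint_U_iff
  have "L2_linear M U"
    unfolding L2_linear_def
  proof (intro conjI allI ballI U_in_L2)
    fix F assume "F \<in> L2 M"
    then obtain f where f: "f \<in> sqint M" "F = ae_class M f" by (rule L2_E)
    have sf: "(\<lambda>x. m\<^sub>0 (\<theta> 0 x) * f (r_hat r x)) \<in> sqint M" using f by simp
    show "U (L2_scale M c F) = L2_scale M c (U F)" for c
      using f sqint_scale[OF f(1), of c] sqint_measurable[OF sf] by (simp add: mult.left_commute)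
    fix G assume "G \<in> L2 M"
    then obtain g where g: "g \<in> sqint M" "G = ae_class M g" by (rule L2_E)
    have sg: "(\<lambda>x. m\<^sub>0 (\<theta> 0 x) * g (r_hat r x)) \<in> sqint M" using g by simp
    show "U (L2_add M F G) = L2_add M (U F) (U G)"
      using f g sqint_add[OF f(1) g(1)] sqint_measurable[OF sf] sqint_measurable[OF sg]
      by (simp add: distrib_left)
  qed
  moreover have "\<forall>F\<in>L2 M. \<forall>G\<in>L2 M. L2_inner M (U F) (U G) = L2_inner M F G"
    by (auto elim!: L2_E simp del: U_class simp: U_inner)
  ultimately show ?thesis using U_bij by (simp add: L2_unitary_def)
qed

section \<open>The representation and the covariance relations\<close>

lemma Linf_comp_theta_0: "f \<in> Linf \<mu> \<Longrightarrow> f \<circ> \<theta> 0 \<in> Linf M"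
  using Linf_comp_nonsingular[of f \<mu> "\<theta> 0" M] AE_theta_0
  by (simp add: measurable_cong_sets[OF refl sets_mu])

lemma pi_representation: "Linf_representation \<mu> M (cov_pi M)"
  using mult_op_Linf_representation[of "\<theta> 0" M \<mu>] AE_theta_0
  by (simp add: cov_pi_def[abs_def] measurable_cong_sets[OF refl sets_mu])

lemma Linf_comp_r_hat: "g \<in> Linf M \<Longrightarrow> g \<circ> r_hat r \<in> Linf M"
  using Linf_comp_nonsingular[of g M "r_hat r" M] AE_r_hat by simp

text \<open>With \<open>F\<close> written as the image under \<open>U\<close> of a representative of
  \<open>V F\<close>, both sides are explicit and no formula for the inverse is needed. The relation
  for \<open>cov_pi\<close> is the case \<open>g = f \<circ> \<theta> 0\<close>.\<close>

lemma U_mult_V: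
  assumes g: "g \<in> Linf M" and F: "F \<in> L2 M"
  shows "U (mult_op M g (V F)) = mult_op M (g \<circ> r_hat r) F"
proof -
  obtain k where k: "k \<in> sqint M" "V F = ae_class M k" using V_in_L2[OF F] by (rule L2_E)
  have km [measurable]: "k \<in> borel_measurable M" using k by (simp add: sqint_measurable)
  have F_eq: "F = ae_class M (\<lambda>x. m\<^sub>0 (\<theta> 0 x) * k (r_hat r x))"
    using U_V[OF F] k by (simp add: U_class)
  have "(\<lambda>x. m\<^sub>0 (\<theta> 0 x) * k (r_hat r x)) \<in> borel_measurable M" by measurable
  then have "mult_op M (g \<circ> r_hat r) F = ae_class M (\<lambda>x. m\<^sub>0 (\<theta> 0 x) * (g (r_hat r x) * k (r_hat r x)))"
    unfolding F_eq by (simp add: mult_op_class mult.left_commute)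
  moreover have "U (mult_op M g (V F)) = ae_class M (\<lambda>x. m\<^sub>0 (\<theta> 0 x) * (g (r_hat r x) * k (r_hat r x)))"
    using sqint_measurable[OF Linf_mult_sqint(1)[OF g k(1)]] km
    by (simp add: k(2) mult_op_class U_class)
  ultimately show ?thesis by simp
qed

lemma U_pi_V:
  assumes "f \<in> Linf \<mu>" "F \<in> L2 M"
  shows "U (cov_pi M f (V F)) = cov_pi M (f \<circ> r) F"
proof -
  have "f \<circ> \<theta> 0 \<circ> r_hat r = f \<circ> r \<circ> \<theta> 0" by (simp add: fun_eq_iff)
  then show ?thesis using U_mult_V[OF Linf_comp_theta_0[OF assms(1)] assms(2)] by (simp add: cov_pi_def)
qed

section \<open>The cyclic vector\<close>

lemma one_sqint: "(\<lambda>_. 1) \<in> sqint M"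
  by (simp add: sqint_def)

lemma pi_phi: "cov_pi M f (cov_phi M) = ae_class M (f \<circ> \<theta> 0)"
  by (simp add: cov_pi_def cov_phi_def mult_op_class comp_def)

lemma Linf_sqint: "f \<in> Linf M \<Longrightarrow> f \<in> sqint M"
  using Linf_mult_sqint(1)[OF _ one_sqint, of f] by simp

lemma phi_pi_phi:
  assumes "f \<in> Linf \<mu>"
  shows "L2_inner M (cov_phi M) (cov_pi M f (cov_phi M)) = (\<integral>x. f x * of_real (h x) \<partial>\<mu>)"
  using integral_theta[OF assms, of 0] Linf_measurable[OF Linf_comp_theta_0[OF assms]]
  unfolding pi_phi by (simp add: cov_phi_def L2_inner_class)

lemma U_phi: "U (cov_phi M) = cov_pi M m\<^sub>0 (cov_phi M)"
  unfolding pi_phi by (simp add: cov_phi_def U_class comp_def)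

text \<open>Each application of \<open>U\<close> lowers the coordinate inside the indicator by one
  and replaces the coefficient \<open>c\<close> by \<open>m\<^sub>0\<close> times
  \<open>c \<circ> r\<close>. Admitting an arbitrary bounded coefficient closes the
  induction.\<close>

lemma U_funpow_theta:
  assumes "c \<in> Linf \<mu>" "A \<in> sets borel"
  shows "\<exists>f\<in>Linf \<mu>. (U ^^ n) (ae_class M (\<lambda>x. c (\<theta> 0 x) * indicator A (\<theta> n x))) = ae_class M (f \<circ> \<theta> 0)"
  using assms(1)
proof (induction n arbitrary: c)
  case 0
  have "(\<lambda>x. c x * indicator A x) \<in> Linf \<mu>"
    using assms(2) sets_mu by (intro Linf_mult 0 Linf_indicator) simp
  then show ?case by (intro bexI[of _ "\<lambda>x. c x * indicator A x"]) (simp_all add: comp_def)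
next
  case (Suc n)
  have [measurable]: "c \<in> borel_measurable borel" "A \<in> sets borel"
    using Linf_measurable[OF Suc.prems] assms(2) by auto
  have "U (ae_class M (\<lambda>x. c (\<theta> 0 x) * indicator A (\<theta> (Suc n) x)))
    = ae_class M (\<lambda>x. (m\<^sub>0 (\<theta> 0 x) * (c \<circ> r) (\<theta> 0 x)) * indicator A (\<theta> n x))"
    by (subst U_class) (measurable, simp add: mult.assoc)
  then show ?case
    using Suc.IH[OF Linf_mult[OF m0_Linf Linf_comp_r[OF Suc.prems]]]
    by (simp add: funpow_Suc_right del: funpow.simps)
qed

lemma V_funpow_in_L2: "F \<in> L2 M \<Longrightarrow> (V ^^ n) F \<in> L2 M"
  by (induction n) (simp_all add: V_in_L2)

lemma V_funpow_U_funpow: "F \<in> L2 M \<Longrightarrow> (V ^^ n) ((U ^^ n) F) = F"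
proof (induction n arbitrary: F)
  case (Suc n)
  have "(V ^^ Suc n) ((U ^^ Suc n) F) = V ((V ^^ n) ((U ^^ n) (U F)))"
    by (simp add: funpow_swap1)
  then show ?case using Suc.IH[OF U_in_L2[OF Suc.prems]] V_U[OF Suc.prems] by simp
qed simp

text \<open>The indicator of a cylinder is itself one of the generators: \<open>U ^^ n\<close> takes
  it to a vector \<open>cov_pi M f (cov_phi M)\<close>, and \<open>V ^^ n\<close> takes that vector
  back.\<close>

lemma closed_span_V_pi_phi:
  "L2_closed_span M {(V ^^ n) (cov_pi M f (cov_phi M)) | n f. f \<in> Linf \<mu>} = L2 M"
proof (rule L2_closed_span_eq_L2[OF _ cyl_Int_stable])
  show "{(V ^^ n) (cov_pi M f (cov_phi M)) | n f. f \<in> Linf \<mu>} \<subseteq> L2 M"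
    by (auto simp: pi_phi intro!: V_funpow_in_L2 ae_class_in_L2 Linf_sqint Linf_comp_theta_0)
  fix X assume X: "X \<in> cyl"
  then obtain n A where XA: "X = \<theta> n -` A \<inter> solenoid r" "A \<in> sets borel" by (auto simp: cyl_def)
  have eq: "ae_class M (indicator X) = ae_class M (\<lambda>x. 1 * indicator A (\<theta> n x))"
    by (rule ae_class_cong, rule AE_I2) (auto simp: XA indicator_def)
  obtain f where f: "f \<in> Linf \<mu>" "(U ^^ n) (ae_class M (indicator X)) = ae_class M (f \<circ> \<theta> 0)"
    using U_funpow_theta[OF Linf_const[of 1] XA(2), of n] unfolding eq by blast
  have "ae_class M (indicator X) \<in> L2 M"
    by (intro ae_class_in_L2 indicator_sqint cyl_sets X)
  then have "ae_class M (indicator X) = (V ^^ n) (cov_pi M f (cov_phi M))"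
    using V_funpow_U_funpow[of "ae_class M (indicator X)" n] f(2) by (simp add: pi_phi)
  then show "ae_class M (indicator X) \<in> {(V ^^ n) (cov_pi M f (cov_phi M)) | n f. f \<in> Linf \<mu>}"
    using f(1) by blast
qed (simp_all add: cyl_subset solenoid_cyl sets_M)

end

theorem theorem5p5:
  fixes r :: "'a::metric_space \<Rightarrow> 'a"
    and \<mu> :: "'a measure"
    and m\<^sub>0 :: "'a \<Rightarrow> complex"
    and h :: "'a \<Rightarrow> real"
    and \<mu>h :: "(nat \<Rightarrow> 'a) measure"
  assumes "compact (UNIV :: 'a set)"
    and "r \<in> borel_measurable borel" and "surj r" and "\<And>x. finite (r -` {x})"
    and "prob_space \<mu>" and "sets \<mu> = sets borel" and "strongly_invariant r \<mu>"
    and "m\<^sub>0 \<in> Linf \<mu>" and "nonsingular \<mu> m\<^sub>0"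
    and "integrable \<mu> h" and "AE x in \<mu>. h x \<ge> 0"
    and "AE x in \<mu>. transfer_op r m\<^sub>0 (\<lambda>y. of_real (h y)) x = of_real (h x)"
    and "is_hat_measure r \<mu> m\<^sub>0 h \<mu>h"
  shows
    "L2_unitary \<mu>h (cov_U r m\<^sub>0 \<mu>h) \<and>
     Linf_representation \<mu> \<mu>h (cov_pi \<mu>h) \<and>
     cov_phi \<mu>h \<in> L2 \<mu>h \<and>
     (\<forall>f\<in>Linf \<mu>. f \<circ> r \<in> Linf \<mu> \<and>
        (\<forall>F\<in>L2 \<mu>h. cov_U r m\<^sub>0 \<mu>h (cov_pi \<mu>h f (inv_into (L2 \<mu>h) (cov_U r m\<^sub>0 \<mu>h) F)) =
           cov_pi \<mu>h (f \<circ> r) F)) \<and>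
     (\<forall>f\<in>Linf \<mu>. L2_inner \<mu>h (cov_phi \<mu>h) (cov_pi \<mu>h f (cov_phi \<mu>h)) =
        (\<integral>x. f x * of_real (h x) \<partial>\<mu>)) \<and>
     cov_U r m\<^sub>0 \<mu>h (cov_phi \<mu>h) = cov_pi \<mu>h m\<^sub>0 (cov_phi \<mu>h) \<and>
     L2_closed_span \<mu>h
       {((inv_into (L2 \<mu>h) (cov_U r m\<^sub>0 \<mu>h)) ^^ n) (cov_pi \<mu>h f (cov_phi \<mu>h)) | n f. f \<in> Linf \<mu>}
       = L2 \<mu>h \<and>
     (\<forall>g\<in>Linf \<mu>h. g \<circ> r_hat r \<in> Linf \<mu>h \<and>
        (\<forall>F\<in>L2 \<mu>h. cov_U r m\<^sub>0 \<mu>h (mult_op \<mu>h g (inv_into (L2 \<mu>h) (cov_U r m\<^sub>0 \<mu>h) F)) =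
           mult_op \<mu>h (g \<circ> r_hat r) F))"
proof -
  interpret covariant_filter r \<mu> m\<^sub>0 h \<mu>h
    by (rule covariant_filter.intro[OF strongly_invariant_map.intro[OF assms(2-7)]
          covariant_filter_axioms.intro[OF assms(8-10,13)]])
  show ?thesis
  proof (intro conjI ballI)
    show "cov_phi \<mu>h \<in> L2 \<mu>h" unfolding cov_phi_def by (rule ae_class_in_L2[OF one_sqint])
  qed (fact U_unitary pi_representation U_phi closed_span_V_pi_phi
      | erule Linf_comp_r U_pi_V phi_pi_phi Linf_comp_r_hat U_mult_V, assumption?)+
qed

end
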